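(* Consider the dynamic optimal control problem of minimizing $I=\int_a^b g(q,\dot q,Q)\,dt$ over curves satisfying the nonholonomic constraints $u^\sigma=\Psi^\sigma_i\dot q^i=0$ ($\sigma=1,\dots,m$) with $q$ and $\dot q$ prescribed at both $t=a$ and $t=b$, where the controls $Q=(Q_I)$ are determined by the dynamical Boltzmann-Hamel equations, and let $C(q,u,a)=g(q,\dot q(q,u),Q(q,u,a))$ be the cost integrand in terms of coordinates, quasi-velocities and quasi-accelerations (it depends only on $q$, $u^I$ and $a^I=\dot u^I$, $I=m+1,\dots,n$). Put $$\kappa_J=\frac{\partial C}{\partial u^J}-\frac{d}{dt}\frac{\partial C}{\partial a^J},\qquad J=m+1,\dots,n.$$ Then the Boltzmann-Hamel equations for optimal dynamic control, i.e. the necessary and sufficient conditions for a smooth curve $q(t)$ and smooth multipliers $\mu_1(t),\dots,\mu_m(t)$, $t\in[a,b]$, to be a stationary point of the augmented cost $$\int_a^b\bigl(C(q,u,a)+\mu_\sigma u^\sigma\bigr)\,dt$$ with respect to arbitrary smooth variations of $\mu$ and arbitrary smooth variations of $q$ (not required to satisfy the constraints) keeping $q$ and $\dot q$ fixed at $t=a$ and $t=b$, are $$-\frac{\partial C}{\partial\theta^A}+\dot\kappa_A-\kappa_J\gamma^J_{SA}u^S=\mu_\tau\gamma^\tau_{SA}u^S,\qquad A=m+1,\dots,n,$$ $$-\frac{\partial C}{\partial\theta^\sigma}-\kappa_J\gamma^J_{S\sigma}u^S=\mu_\tau\gamma^\tau_{S\sigma}u^S-\dot\mu_\sigma,\qquad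 \sigma=1,\dots,m,$$ $$\dot q^i=\Phi^i_Su^S,\qquad i=1,\dots,n.$$
   Context: Index and summation convention: repeated indices are summed; Greek indices ($\sigma,\tau,\dots$) run over $1,\dots,m$ (constrained directions), capital Latin indices ($A,I,J,K,S,\dots$) over $m+1,\dots,n$ (unconstrained directions), lower-case Latin indices over $1,\dots,n$. All functions are smooth. Setting: the configuration manifold is $n$-dimensional with local coordinates $q=(q^1,\dots,q^n)$; curves are considered in such a coordinate domain. The system is subject to $m$ linear time-independent nonholonomic constraints $a^\sigma_i(q)\dot q^i=0$. $\Psi(q)=(\Psi^j_i(q))$ is an invertible $n\times n$ matrix depending smoothly on $q$, with first $m$ rows $\Psi^\sigma_i=a^\sigma_i$ and remaining rows chosen freely subject to invertibility; $\Phi(q)=(\Phi^i_j(q))$ is the inverse matrix of $\Psi(q)$. Quasi-velocities and quasi-accelerations: along a curve $q(t)$, $u^j=\Psi^j_i(q)\dot q^i$ and $a^j=\dot u^j$ (not to be confused with the time endpoint $a$ or the constraint coefficients $a^\sigma_i$); so $\dot q^i=\Phi^i_ju^j$ and the constraints read $u^\sigma=0$ (whence $a^\sigma=0$). Quasi-basis derivatives: for a function $F$ of $q$, $u$ (and $a$), $\dfrac{\partial F}{\partial\theta^i}=\Phi^j_i\dfrac{\partial F}{\partial q^j}$, where $\partial/\partial q^j$ is taken with the quasi-velocities and quasi-accelerations held fixed. Hamel coefficients: $\gamma^s_{pq}=\left(\dfrac{\partial\Psi^s_i}{\partial q^j}-\dfrac{\partial\Psi^s_j}{\partial q^i}\right)\Phi^i_p\Phi^j_q$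 (here $p,q,s$ are indices in $1,\dots,n$). Controls: let $L(q,\dot q)$ be the unconstrained mechanical Lagrangian and $\mathscr L(q,u)=L(q,\dot q(q,u))$ its expression in quasi-velocities. The system has $n-m$ independent acceleration controls $Q_I$, related to the motion by the dynamical Boltzmann-Hamel equations $$\frac{d}{dt}\frac{\partial\mathscr L}{\partial u^I}-\frac{\partial\mathscr L}{\partial\theta^I}-\frac{\partial\mathscr L}{\partial u^j}\gamma^j_{KI}u^K=Q_I,\qquad \dot q^i=\Phi^i_Ju^J,$$ where the constraints $u^\sigma=0$ (and $a^\sigma=0$) are imposed after the partial derivatives are taken. The first set of equations expresses $Q_I$ as an explicit function $Q_I(q,u,a)$ of $q$, $u^J$, $a^J$; together with $\dot q^i=\Phi^i_Ju^J$, this is what is substituted into $g(q,\dot q,Q)$ to obtain $C(q,u,a)$, which is therefore independent of $u^\sigma$ and $a^\sigma$. Variations: a variation of a curve $q(t)$ is a smooth family $q(s,t)$, $s\in[-\varepsilon,\varepsilon]$, $t\in[a,b]$, with $q(0,t)=q(t)$; keeping $q$ and $\dot q$ fixed at the endpoints means that $q(s,t)$ and $\partial q(s,t)/\partial t$ are independent of $s$ at $t=a$ and $t=b$. Variations of $\mu$ are smooth families $\mu(s,t)$ with $\mu(0,t)=\mu(t)$. Stationary means that the derivative with respect to $s$ at $s=0$ of the functional vanishes for all such variations. *)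

theory Defs
  imports "HOL-Analysis.Analysis"
begin

text \<open>
  Conventions. Coordinates are indexed by a finite type \<open>'n\<close>; \<open>M :: 'n set\<close> is the set of
  constrained (Greek) indices, \<open>- M\<close> the set of unconstrained (capital Latin) ones. The rows of
  \<open>\<Psi> x\<close> are indexed by the upper index: \<open>\<Psi> x $ j $ i\<close> is $\Psi^j_i(x)$.
\<close>

section \<open>Smoothness and derivatives\<close>

text \<open>
  The derivatives are taken within \<open>S\<close>, so that the notion applies both to open sets and to
  intervals and rectangles (one-sided derivatives at the boundary). It is meant for sets \<open>S\<close> on
  which the derivative is unique, i.e. open sets and convex sets with nonempty interior.
\<close>

fun Ck_on :: "nat \<Rightarrow> 'a::real_normed_vector set \<Rightarrow> ('a \<Rightarrow> 'b::real_normed_vector) \<Rightarrow> bool" where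
  "Ck_on 0 S f \<longleftrightarrow> continuous_on S f"
| "Ck_on (Suc k) S f \<longleftrightarrow>
     f differentiable_on S \<and> (\<forall>v. Ck_on k S (\<lambda>x. frechet_derivative f (at x within S) v))"

definition smooth_on :: "'a::real_normed_vector set \<Rightarrow> ('a \<Rightarrow> 'b::real_normed_vector) \<Rightarrow> bool" where
  "smooth_on S f \<longleftrightarrow> (\<forall>k. Ck_on k S f)"

definition pd :: "(real^'n \<Rightarrow> real) \<Rightarrow> 'n \<Rightarrow> real^'n \<Rightarrow> real" where
  "pd f j x = deriv (\<lambda>h. f (x + h *\<^sub>R axis j 1)) 0"

abbreviation ddt :: "real set \<Rightarrow> (real \<Rightarrow> 'a::real_normed_vector) \<Rightarrow> real \<Rightarrow> 'a" where
  "ddt T f t \<equiv> vector_derivative f (at t within T)"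

section \<open>Quasi-velocities\<close>

definition Phi :: "(real^'n \<Rightarrow> real^'n^'n) \<Rightarrow> real^'n \<Rightarrow> real^'n^'n" where
  "Phi \<Psi> x = matrix_inv (\<Psi> x)"

definition quasi_vel :: "(real^'n \<Rightarrow> real^'n^'n) \<Rightarrow> real set \<Rightarrow> (real \<Rightarrow> real^'n) \<Rightarrow> real \<Rightarrow> real^'n" where
  "quasi_vel \<Psi> T q t = \<Psi> (q t) *v ddt T q t"

definition quasi_acc :: "(real^'n \<Rightarrow> real^'n^'n) \<Rightarrow> real set \<Rightarrow> (real \<Rightarrow> real^'n) \<Rightarrow> real \<Rightarrow> real^'n" where
  "quasi_acc \<Psi> T q = ddt T (quasi_vel \<Psi> T q)"

definition dtheta :: "(real^'n \<Rightarrow> real^'n^'n) \<Rightarrow> (real^'n \<Rightarrow> real) \<Rightarrow> 'n \<Rightarrow> real^'n \<Rightarrow> real" where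
  "dtheta \<Psi> F i x = (\<Sum>j\<in>UNIV. Phi \<Psi> x $ j $ i * pd F j x)"

text \<open>\<open>hamel \<Psi> x s p r\<close> is $\gamma^s_{pr}(x)$.\<close>

definition hamel :: "(real^'n \<Rightarrow> real^'n^'n) \<Rightarrow> real^'n \<Rightarrow> 'n \<Rightarrow> 'n \<Rightarrow> 'n \<Rightarrow> real" where
  "hamel \<Psi> x s p r =
     (\<Sum>i\<in>UNIV. \<Sum>j\<in>UNIV.
        (pd (\<lambda>y. \<Psi> y $ s $ i) j x - pd (\<lambda>y. \<Psi> y $ s $ j) i x) * Phi \<Psi> x $ i $ p * Phi \<Psi> x $ j $ r)"

section \<open>Controls and cost\<close>

text \<open>Imposes the constraints, i.e. sets the components with index in \<open>M\<close> to zero.\<close>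

definition unconstr :: "'n set \<Rightarrow> real^'n \<Rightarrow> real^'n" where
  "unconstr M u = (\<chi> i. if i \<in> M then 0 else u $ i)"

definition quasi_lagrangian ::
  "(real^'n \<Rightarrow> real^'n^'n) \<Rightarrow> (real^'n \<Rightarrow> real^'n \<Rightarrow> real) \<Rightarrow> real^'n \<Rightarrow> real^'n \<Rightarrow> real" where
  "quasi_lagrangian \<Psi> L x u = L x (Phi \<Psi> x *v u)"

text \<open>
  The function $Q_I(q,u,a)$ given by the left-hand side of the dynamical Boltzmann-Hamel equations:
  the time derivative of $\partial\mathscr L/\partial u^I$ is expanded by the chain rule with
  $\dot q^j = \Phi^j_K u^K$ and $\dot u^J = a^J$, and the constraints are imposed after the
  partial derivatives are taken. Controls are vectors whose components with index in \<open>M\<close> are zero.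
  The lemma \<open>controls_boltzmann_hamel\<close> below gives back the equations with their time derivative.
\<close>

definition controls ::
  "(real^'n \<Rightarrow> real^'n^'n) \<Rightarrow> 'n set \<Rightarrow> (real^'n \<Rightarrow> real^'n \<Rightarrow> real)
    \<Rightarrow> real^'n \<Rightarrow> real^'n \<Rightarrow> real^'n \<Rightarrow> real^'n" where
  "controls \<Psi> M L x u a =
    (let \<L> = quasi_lagrangian \<Psi> L; w = unconstr M u in
     (\<chi> I. if I \<in> M then 0 else
        (\<Sum>j\<in>UNIV. pd (\<lambda>y. pd (\<L> y) I w) j x * (\<Sum>K\<in>- M. Phi \<Psi> x $ j $ K * u $ K))
        + (\<Sum>J\<in>- M. pd (pd (\<L> x) I) J w * a $ J)
        - dtheta \<Psi> (\<lambda>y. \<L> y w) I x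
        - (\<Sum>j\<in>UNIV. \<Sum>K\<in>- M. pd (\<L> x) j w * hamel \<Psi> x j K I * u $ K)))"

definition cost ::
  "(real^'n \<Rightarrow> real^'n^'n) \<Rightarrow> 'n set \<Rightarrow> (real^'n \<Rightarrow> real^'n \<Rightarrow> real)
    \<Rightarrow> (real^'n \<Rightarrow> real^'n \<Rightarrow> real^'n \<Rightarrow> real) \<Rightarrow> real^'n \<Rightarrow> real^'n \<Rightarrow> real^'n \<Rightarrow> real" where
  "cost \<Psi> M L g x u a = g x (Phi \<Psi> x *v unconstr M u) (controls \<Psi> M L x u a)"

section \<open>The variational problem\<close>

text \<open>In the following, \<open>C x u a\<close> is a cost integrand and \<open>\<mu> \<sigma> t\<close> (\<open>\<sigma> \<in> M\<close>) are the multipliers.\<close>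

definition augmented_cost ::
  "(real^'n \<Rightarrow> real^'n^'n) \<Rightarrow> 'n set \<Rightarrow> (real^'n \<Rightarrow> real^'n \<Rightarrow> real^'n \<Rightarrow> real) \<Rightarrow> real \<Rightarrow> real
    \<Rightarrow> (real \<Rightarrow> real^'n) \<Rightarrow> ('n \<Rightarrow> real \<Rightarrow> real) \<Rightarrow> real" where
  "augmented_cost \<Psi> M C a b q \<mu> =
     integral {a..b} (\<lambda>t. C (q t) (quasi_vel \<Psi> {a..b} q t) (quasi_acc \<Psi> {a..b} q t)
                        + (\<Sum>\<sigma>\<in>M. \<mu> \<sigma> t * quasi_vel \<Psi> {a..b} q t $ \<sigma>))"

definition curve_variation ::
  "(real^'n) set \<Rightarrow> real \<Rightarrow> real \<Rightarrow> real \<Rightarrow> (real \<Rightarrow> real^'n) \<Rightarrow> (real \<Rightarrow> real \<Rightarrow> real^'n) \<Rightarrow> bool" where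
  "curve_variation U a b \<epsilon> q qv \<longleftrightarrow>
     smooth_on ({-\<epsilon>..\<epsilon>} \<times> {a..b}) (\<lambda>(s, t). qv s t)
     \<and> (\<forall>s\<in>{-\<epsilon>..\<epsilon>}. \<forall>t\<in>{a..b}. qv s t \<in> U)
     \<and> (\<forall>t\<in>{a..b}. qv 0 t = q t)
     \<and> (\<forall>s\<in>{-\<epsilon>..\<epsilon>}. \<forall>t\<in>{a, b}. qv s t = q t \<and> ddt {a..b} (qv s) t = ddt {a..b} q t)"

definition multiplier_variation ::
  "'n set \<Rightarrow> real \<Rightarrow> real \<Rightarrow> real \<Rightarrow> ('n \<Rightarrow> real \<Rightarrow> real) \<Rightarrow> (real \<Rightarrow> 'n \<Rightarrow> real \<Rightarrow> real) \<Rightarrow> bool" where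
  "multiplier_variation M a b \<epsilon> \<mu> \<mu>v \<longleftrightarrow>
     (\<forall>\<sigma>\<in>M. smooth_on ({-\<epsilon>..\<epsilon>} \<times> {a..b}) (\<lambda>(s, t). \<mu>v s \<sigma> t)
       \<and> (\<forall>t\<in>{a..b}. \<mu>v 0 \<sigma> t = \<mu> \<sigma> t))"

definition stationary ::
  "(real^'n \<Rightarrow> real^'n^'n) \<Rightarrow> 'n set \<Rightarrow> (real^'n \<Rightarrow> real^'n \<Rightarrow> real^'n \<Rightarrow> real)
    \<Rightarrow> (real^'n) set \<Rightarrow> real \<Rightarrow> real \<Rightarrow> (real \<Rightarrow> real^'n) \<Rightarrow> ('n \<Rightarrow> real \<Rightarrow> real) \<Rightarrow> bool" where
  "stationary \<Psi> M C U a b q \<mu> \<longleftrightarrow>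
     (\<forall>\<epsilon>>0. \<forall>qv \<mu>v. curve_variation U a b \<epsilon> q qv \<and> multiplier_variation M a b \<epsilon> \<mu> \<mu>v \<longrightarrow>
        ((\<lambda>s. augmented_cost \<Psi> M C a b (qv s) (\<mu>v s)) has_real_derivative 0) (at 0))"

definition kappa ::
  "(real^'n \<Rightarrow> real^'n^'n) \<Rightarrow> (real^'n \<Rightarrow> real^'n \<Rightarrow> real^'n \<Rightarrow> real) \<Rightarrow> real set
    \<Rightarrow> (real \<Rightarrow> real^'n) \<Rightarrow> 'n \<Rightarrow> real \<Rightarrow> real" where
  "kappa \<Psi> C T q J t =
     pd (\<lambda>v. C (q t) v (quasi_acc \<Psi> T q t)) J (quasi_vel \<Psi> T q t)
     - ddt T (\<lambda>\<tau>. pd (C (q \<tau>) (quasi_vel \<Psi> T q \<tau>)) J (quasi_acc \<Psi> T q \<tau>)) t"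

section \<open>The controls along a constrained curve\<close>

lemma pd_frechet:
  assumes "((\<lambda>x. f x) has_derivative D) (at x)"
  shows "pd f j x = D (axis j 1)"
proof -
  interpret D: bounded_linear D using assms by (rule has_derivative_bounded_linear)
  have "((\<lambda>h::real. x + h *\<^sub>R axis j 1) has_derivative (\<lambda>h. h *\<^sub>R axis j 1)) (at 0)"
    by (auto intro!: derivative_eq_intros)
  from has_derivative_compose[OF this, of f D]
  have "((\<lambda>h. f (x + h *\<^sub>R axis j 1)) has_derivative (\<lambda>h. D (h *\<^sub>R axis j 1))) (at 0)"
    using assms by simp
  then have "((\<lambda>h. f (x + h *\<^sub>R axis j 1)) has_real_derivative D (axis j 1)) (at 0)"
    unfolding has_field_derivative_def
    by (rule has_derivative_eq_rhs) (auto simp: D.scaleR)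
  then show ?thesis unfolding pd_def by (rule DERIV_imp_deriv)
qed

lemma controls_boltzmann_hamel:
  fixes q :: "real \<Rightarrow> real^'n" and a b :: real
    and \<Psi> :: "real^'n \<Rightarrow> real^'n^'n" and L :: "real^'n \<Rightarrow> real^'n \<Rightarrow> real"
  defines "u \<equiv> quasi_vel \<Psi> {a..b} q" and "\<L> \<equiv> quasi_lagrangian \<Psi> L"
  assumes ab: "a < b" and t: "t \<in> {a..b}" and I: "I \<notin> M"
    and inv: "invertible (\<Psi> (q t))"
    and q: "q differentiable (at t within {a..b})"
    and u: "u differentiable (at t within {a..b})"
    and constr: "\<And>\<tau> \<sigma>. \<tau> \<in> {a..b} \<Longrightarrow> \<sigma> \<in> M \<Longrightarrow> u \<tau> $ \<sigma> = 0"
    and L: "(\<lambda>(x, v). pd (\<L> x) I v) differentiable (at (q t, u t))"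
  shows "ddt {a..b} (\<lambda>\<tau>. pd (\<L> (q \<tau>)) I (u \<tau>)) t - dtheta \<Psi> (\<lambda>y. \<L> y (u t)) I (q t)
      - (\<Sum>j\<in>UNIV. \<Sum>K\<in>- M. pd (\<L> (q t)) j (u t) * hamel \<Psi> (q t) j K I * u t $ K)
    = controls \<Psi> M L (q t) (u t) (quasi_acc \<Psi> {a..b} q t) $ I"
proof -
  let ?T = "{a..b}"
  define G where "G = (\<lambda>(x, v). pd (\<L> x) I v)"
  define q' u' where "q' = ddt ?T q t" and "u' = ddt ?T u t"
  from L obtain D where D: "(G has_derivative D) (at (q t, u t))"
    unfolding G_def differentiable_def by blast
  interpret D: bounded_linear D using D by (rule has_derivative_bounded_linear)
  have nb: "at t within ?T \<noteq> bot"
    using ab t by (simp add: trivial_limit_within islimpt_Icc)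
  have dq: "(q has_vector_derivative q') (at t within ?T)"
    and du: "(u has_vector_derivative u') (at t within ?T)"
    using q u unfolding q'_def u'_def by (simp_all add: vector_derivative_works)
  have w: "unconstr M (u t) = u t"
    using constr[OF t] by (auto simp: unconstr_def vec_eq_iff)
  have u'0: "u' $ \<sigma> = 0" if "\<sigma> \<in> M" for \<sigma>
  proof -
    have "((\<lambda>\<tau>. u \<tau> $ \<sigma>) has_vector_derivative u' $ \<sigma>) (at t within ?T)"
      using bounded_linear.has_vector_derivative[OF bounded_linear_vec_nth du] .
    moreover have "((\<lambda>\<tau>. u \<tau> $ \<sigma>) has_vector_derivative 0) (at t within ?T)"
      by (rule has_vector_derivative_transform[OF t _ has_vector_derivative_const[of 0]])
         (simp add: constr that)
    ultimately show ?thesis using vector_derivative_unique_within[OF nb] by blast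
  qed
  have q'eq: "q' $ j = (\<Sum>K\<in>- M. Phi \<Psi> (q t) $ j $ K * u t $ K)" for j
  proof -
    have "matrix_inv (\<Psi> (q t)) ** \<Psi> (q t) = mat 1"
      using inv unfolding invertible_def matrix_inv_def
      by (rule someI2_ex) simp
    then have "q' = Phi \<Psi> (q t) *v u t"
      by (simp add: u_def quasi_vel_def q'_def Phi_def matrix_vector_mul_assoc)
    then have "q' $ j = (\<Sum>K\<in>UNIV. Phi \<Psi> (q t) $ j $ K * u t $ K)"
      by (simp add: matrix_vector_mult_def)
    also have "\<dots> = (\<Sum>K\<in>- M. Phi \<Psi> (q t) $ j $ K * u t $ K)"
      by (rule sum.mono_neutral_right) (auto simp: constr[OF t])
    finally show ?thesis .
  qed
  have Dq: "pd (\<lambda>y. pd (\<L> y) I (u t)) j (q t) = D (axis j 1, 0)" for j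
  proof -
    have "((\<lambda>y. (y, u t)) has_derivative (\<lambda>h. (h, 0))) (at (q t))"
      by (auto intro!: derivative_eq_intros)
    from has_derivative_compose[OF this D] show ?thesis
      using pd_frechet[of "\<lambda>y. pd (\<L> y) I (u t)"] by (simp add: G_def)
  qed
  have Du: "pd (pd (\<L> (q t)) I) j (u t) = D (0, axis j 1)" for j
  proof -
    have "((\<lambda>v. (q t, v)) has_derivative (\<lambda>h. (0, h))) (at (u t))"
      by (auto intro!: derivative_eq_intros)
    from has_derivative_compose[OF this D] show ?thesis
      using pd_frechet[of "pd (\<L> (q t)) I"] by (simp add: G_def)
  qed
  have b: "bounded_linear (\<lambda>h. D (h, 0))" "bounded_linear (\<lambda>h. D (0, h))"
    by (auto intro!: bounded_linear_compose[OF D.bounded_linear_axioms]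
        bounded_linear_Pair bounded_linear_ident bounded_linear_zero)
  have expand: "F h = (\<Sum>j\<in>UNIV. F (axis j 1) * h $ j)"
    if "bounded_linear F" for F :: "real^'n \<Rightarrow> real" and h
  proof -
    interpret F: bounded_linear F by fact
    have "F h = F (\<Sum>j\<in>UNIV. h $ j *\<^sub>R axis j 1)"
      using basis_expansion[of h] by (simp only: scalar_mult_eq_scaleR)
    then show ?thesis by (simp only: F.sum F.scaleR real_scaleR_def mult.commute)
  qed
  have "D (q', u') = D (q', 0) + D (0, u')"
    by (simp flip: D.add)
  also have "D (q', 0) = (\<Sum>j\<in>UNIV. D (axis j 1, 0) * q' $ j)"
    by (rule expand[OF b(1)])
  also have "D (0, u') = (\<Sum>j\<in>UNIV. D (0, axis j 1) * u' $ j)"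
    by (rule expand[OF b(2)])
  also have "\<dots> = (\<Sum>j\<in>- M. D (0, axis j 1) * u' $ j)"
    by (rule sum.mono_neutral_right) (auto simp: u'0)
  finally have Dsum: "D (q', u') = (\<Sum>j\<in>UNIV. D (axis j 1, 0) * q' $ j)
      + (\<Sum>j\<in>- M. D (0, axis j 1) * u' $ j)" .
  have "((\<lambda>\<tau>. (q \<tau>, u \<tau>)) has_vector_derivative (q', u')) (at t within ?T)"
    using dq du by (rule has_vector_derivative_Pair)
  from vector_derivative_diff_chain_within[OF this has_derivative_at_withinI[OF D]]
  have "(G \<circ> (\<lambda>\<tau>. (q \<tau>, u \<tau>)) has_vector_derivative D (q', u')) (at t within ?T)" .
  then have "ddt ?T (\<lambda>\<tau>. pd (\<L> (q \<tau>)) I (u \<tau>)) t = D (q', u')"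
    using vector_derivative_within[OF nb] by (fastforce simp: G_def o_def)
  then show ?thesis
    using I by (simp add: controls_def Let_def w flip: \<L>_def)
      (simp add: Dsum Dq Du q'eq quasi_acc_def flip: u_def u'_def)
qed

end

theory Submission
  imports Defs
begin

text \<open>
  Write \<open>\<xi> = \<delta>q\<close>, \<open>\<eta> = \<Psi> \<xi>\<close> and \<open>\<upsilon> = \<delta>u\<close>. Commuting the two derivatives of \<open>q(s, t)\<close> gives the
  transpositional relation $\upsilon^j = \dot\eta^j + \gamma^j_{pr} u^p \eta^r$. In the first
  variation, integrating $\partial C / \partial a^J$ by parts once turns the coefficient of
  $\upsilon^J$ into $\kappa_J$, so that with $\lambda = (\mu_\sigma, \kappa_J)$ a second integration by
  parts leaves
  $\int (E_r \eta^r + \delta\mu_\sigma u^\sigma)\,dt$ with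
  $E_r = \partial C / \partial\theta^r - \dot\lambda_r + \lambda_j \gamma^j_{pr} u^p$; the boundary terms
  vanish because \<open>\<eta>\<close> and \<open>\<upsilon>\<close> do. Since $E$ is itself smooth, testing with
  $\delta q = ((t - a)(b - t))^2\, \Psi^T E$ and $\delta\mu_\sigma = u^\sigma$ shows that stationarity
  forces $E = 0$ and $u^\sigma = 0$.
\<close>

section \<open>Calculus of smooth functions\<close>

text \<open>The cost involves second derivatives of the curve: this is why two integrations by parts
  occur and why both \<open>q\<close> and its velocity are fixed at the endpoints. Variations live
  on a closed rectangle with one-sided derivatives at its edges, so every argument that treats a
  derivative as a function, including the exchange of \<open>s\<close>- and
  \<open>t\<close>-derivatives, has to work up to the boundary. This calls for a calculus on all
  sets where derivatives are unique, not only on open ones. Since \<open>C\<close> ignores the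
  constrained components of \<open>u\<close> and \<open>a\<close>, no partial derivative of
  \<open>C\<close> competes with \<mu> in those directions, and \<mu> and \<kappa> merge into a
  single costate defined for every index. Varied curves may violate the constraints, and the
  constraints on the base curve are themselves a consequence of varying \<mu>. Hence
  \<open>E\<close> keeps all quasi-velocities, and the passage to sums over unconstrained indices is
  made only at the end, under the assumption \<open>u^\<sigma> = 0\<close>.\<close>

text \<open>On these sets derivatives within \<open>S\<close> are unique.\<close>

definition thick :: "'a::euclidean_space set \<Rightarrow> bool" where
  "thick S \<longleftrightarrow> (\<forall>x\<in>S. \<forall>i\<in>Basis. \<forall>e>0. \<exists>d. 0 < \<bar>d\<bar> \<and> \<bar>d\<bar> < e \<and> x + d *\<^sub>R i \<in> S)"

text \<open>A linear map is determined by its values on \<open>Basis\<close>, and each of these is a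
  limit of difference quotients along one axis. The sign of \<open>d\<close> in \<open>thick\<close>
  is left free, so one-sided access, as at an endpoint, is enough.\<close>

lemma thick_unique:
  fixes f :: "'a::euclidean_space \<Rightarrow> 'b::real_normed_vector"
  assumes "thick S" "x \<in> S" "(f has_derivative D) (at x within S)"
    "(f has_derivative D') (at x within S)"
  shows "D = D'"
  using assms unfolding thick_def
  by (intro frechet_derivative_unique_within[of f D x S D']) blast+

lemma thick_frechet_derivative:
  assumes "thick S" "x \<in> S" "(f has_derivative D) (at x within S)"
  shows "frechet_derivative f (at x within S) = D"
  using thick_unique[OF assms(1,2) _ assms(3)] assms(3) frechet_derivative_works
  by (metis differentiableI)

lemma thick_open:
  assumes "open S"
  shows "thick S"
  unfolding thick_def
proof (intro ballI allI impI)
  fix x i :: 'a and e :: real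
  assume x: "x \<in> S" and i: "i \<in> Basis" and e: "0 < e"
  obtain r where r: "r > 0" "ball x r \<subseteq> S" using assms x openE by blast
  show "\<exists>d. 0 < \<bar>d\<bar> \<and> \<bar>d\<bar> < e \<and> x + d *\<^sub>R i \<in> S"
    using r e i by (intro exI[of _ "min (e/2) (r/2)"]) (auto intro!: subsetD[OF r(2)] simp: dist_norm)
qed

lemma thick_interval:
  fixes a b :: real
  assumes "a < b"
  shows "thick {a..b}"
  unfolding thick_def
proof (intro ballI allI impI)
  fix x i e :: real
  assume x: "x \<in> {a..b}" and i: "i \<in> Basis" and e: "0 < e"
  show "\<exists>d. 0 < \<bar>d\<bar> \<and> \<bar>d\<bar> < e \<and> x + d *\<^sub>R i \<in> {a..b}"
  proof (cases "x < b")
    case True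
    with x i e show ?thesis by (intro exI[of _ "min (e/2) (b-x)"]) auto
  next
    case False
    with x i e assms show ?thesis by (intro exI[of _ "- min (e/2) (b-a)"]) auto
  qed
qed

lemma thick_Times:
  assumes "thick S" "thick T"
  shows "thick (S \<times> T)"
  unfolding thick_def
proof (intro ballI allI impI)
  fix x i :: "'a \<times> 'b" and e :: real
  assume x: "x \<in> S \<times> T" and i: "i \<in> Basis" and e: "0 < e"
  obtain y z where yz: "x = (y, z)" "y \<in> S" "z \<in> T" using x by blast
  from i consider (1) j where "j \<in> Basis" "i = (j, 0)" | (2) j where "j \<in> Basis" "i = (0, j)"
    by (auto simp: Basis_prod_def)
  then show "\<exists>d. 0 < \<bar>d\<bar> \<and> \<bar>d\<bar> < e \<and> x + d *\<^sub>R i \<in> S \<times> T"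
  proof cases
    case 1
    with assms(1) yz e obtain d where "0 < \<bar>d\<bar>" "\<bar>d\<bar> < e" "y + d *\<^sub>R j \<in> S"
      unfolding thick_def by blast
    with 1 yz show ?thesis by auto
  next
    case 2
    with assms(2) yz e obtain d where "0 < \<bar>d\<bar>" "\<bar>d\<bar> < e" "z + d *\<^sub>R j \<in> T"
      unfolding thick_def by blast
    with 2 yz show ?thesis by auto
  qed
qed

section \<open>Functions of class C^k on a thick set\<close>

text \<open>\<open>frechet_derivative\<close> is a choice from the predicate
  \<open>has_derivative\<close>. Both functions satisfy that predicate for the same maps, so the
  choices coincide even where no derivative exists.\<close>

lemma frechet_derivative_within_cong:
  assumes "x \<in> S" "\<And>y. y \<in> S \<Longrightarrow> f y = g y"
  shows "frechet_derivative f (at x within S) = frechet_derivative g (at x within S)"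
proof -
  have "(f has_derivative D) (at x within S) \<longleftrightarrow> (g has_derivative D) (at x within S)" for D
    using assms by (metis has_derivative_transform)
  then show ?thesis by (simp add: frechet_derivative_def)
qed

lemma Ck_on_cong:
  assumes "\<And>x. x \<in> S \<Longrightarrow> f x = g x"
  shows "Ck_on k S f \<longleftrightarrow> Ck_on k S g"
  using assms
proof (induction k arbitrary: f g)
  case 0
  then show ?case by (auto cong: continuous_on_cong)
next
  case (Suc k)
  have "f differentiable_on S \<longleftrightarrow> g differentiable_on S"
    using Suc.prems unfolding differentiable_on_def differentiable_def
    by (metis has_derivative_transform)
  moreover have "Ck_on k S (\<lambda>x. frechet_derivative f (at x within S) v) \<longleftrightarrow>
      Ck_on k S (\<lambda>x. frechet_derivative g (at x within S) v)" for v
  proof (rule Suc.IH)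
    fix x assume "x \<in> S"
    from frechet_derivative_within_cong[of x S f g, OF this Suc.prems]
    show "frechet_derivative f (at x within S) v = frechet_derivative g (at x within S) v" by simp
  qed
  ultimately show ?case by simp
qed

lemma Ck_on_SucD: "Ck_on (Suc k) S f \<Longrightarrow> Ck_on k S f"
proof (induction k arbitrary: f)
  case 0
  then show ?case by (simp add: differentiable_imp_continuous_on)
next
  case (Suc k)
  then show ?case by (metis Ck_on.simps(2))
qed

lemma Ck_on_Suc_has_derivative:
  assumes "Ck_on (Suc k) S f" "x \<in> S"
  shows "(f has_derivative frechet_derivative f (at x within S)) (at x within S)"
  using assms by (simp add: differentiable_on_def flip: frechet_derivative_works)

text \<open>Uniqueness on thick sets lets any explicit derivative formula \<open>D\<close> stand in
  for the chosen \<open>frechet_derivative\<close>. The closure properties below then reduce to a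
  differentiation rule plus induction on \<open>k\<close>.\<close>

lemma Ck_on_SucI:
  assumes "thick S" "\<And>x. x \<in> S \<Longrightarrow> (f has_derivative D x) (at x within S)"
    "\<And>v. Ck_on k S (\<lambda>x. D x v)"
  shows "Ck_on (Suc k) S f"
proof -
  have "Ck_on k S (\<lambda>x. frechet_derivative f (at x within S) v) \<longleftrightarrow> Ck_on k S (\<lambda>x. D x v)" for v
    using thick_frechet_derivative[OF assms(1) _ assms(2)] by (intro Ck_on_cong) auto
  then show ?thesis
    using assms by (auto simp: differentiable_on_def intro: differentiableI)
qed

lemma Ck_on_const: "thick S \<Longrightarrow> Ck_on k S (\<lambda>x. c)"
proof (induction k arbitrary: c)
  case (Suc k)
  show ?case
    by (rule Ck_on_SucI[where D = "\<lambda>x v. 0"]) (auto intro: Suc)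
qed simp

lemma Ck_on_linear:
  assumes "thick S" "bounded_linear h" "Ck_on k S f"
  shows "Ck_on k S (\<lambda>x. h (f x))"
  using assms(3)
proof (induction k arbitrary: f)
  case 0
  then show ?case
    using assms(2) by (auto intro: bounded_linear.continuous_on)
next
  case (Suc k)
  show ?case
    by (rule Ck_on_SucI[OF assms(1) bounded_linear.has_derivative[OF assms(2)
            Ck_on_Suc_has_derivative[OF Suc.prems]]])
       (use Suc in auto)
qed

lemma Ck_on_add:
  assumes "thick S" "Ck_on k S f" "Ck_on k S g"
  shows "Ck_on k S (\<lambda>x. f x + g x)"
  using assms(2,3)
proof (induction k arbitrary: f g)
  case 0
  then show ?case by (simp add: continuous_on_add)
next
  case (Suc k)
  show ?case
    by (rule Ck_on_SucI[OF assms(1) has_derivative_add[OF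
            Ck_on_Suc_has_derivative[OF Suc.prems(1)] Ck_on_Suc_has_derivative[OF Suc.prems(2)]]])
       (use Suc in auto)
qed

text \<open>By the Leibniz rule the derivative is again a sum of values of \<open>h\<close>, with
  one factor differentiated. The induction therefore varies \<open>f\<close> and \<open>g\<close>,
  and \<open>Ck_on_SucD\<close> lowers the order of the untouched factor.\<close>

lemma Ck_on_bilinear:
  assumes "thick S" "bounded_bilinear h" "Ck_on k S f" "Ck_on k S g"
  shows "Ck_on k S (\<lambda>x. h (f x) (g x))"
  using assms(3,4)
proof (induction k arbitrary: f g)
  case 0
  then show ?case using assms(2) by (auto intro: bounded_bilinear.continuous_on)
next
  case (Suc k)
  show ?case
    by (rule Ck_on_SucI[OF assms(1) bounded_bilinear.FDERIV[OF assms(2)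
            Ck_on_Suc_has_derivative[OF Suc.prems(1)] Ck_on_Suc_has_derivative[OF Suc.prems(2)]]])
       (use Suc.prems in \<open>simp_all add: Ck_on_add[OF assms(1)] Suc.IH
          Ck_on_SucD[OF Suc.prems(1)] Ck_on_SucD[OF Suc.prems(2)]\<close>)
qed

lemma Ck_on_sum:
  assumes "thick S" "\<And>i. i \<in> I \<Longrightarrow> Ck_on k S (f i)"
  shows "Ck_on k S (\<lambda>x. \<Sum>i\<in>I. f i x)"
  using assms(2)
  by (induction I rule: infinite_finite_induct)
     (auto intro: Ck_on_const Ck_on_add assms(1))

text \<open>The chain rule evaluates the derivative of \<open>g\<close> on a direction that varies
  with \<open>x\<close>, whereas \<open>Ck_on\<close> speaks of fixed directions only. Expanding
  over \<open>Basis\<close> gives products of components of the derivative of \<open>f\<close> with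
  fixed-direction derivatives of \<open>g\<close> at \<open>f x\<close>; the induction hypothesis
  applies to the latter, so the induction generalises over \<open>g\<close>.\<close>

lemma Ck_on_compose:
  fixes f :: "'a::euclidean_space \<Rightarrow> 'b::euclidean_space" and g :: "'b \<Rightarrow> 'c::real_normed_vector"
  assumes "thick S" "Ck_on k S f" "Ck_on k T g" "f ` S \<subseteq> T"
  shows "Ck_on k S (\<lambda>x. g (f x))"
  using assms(2,3)
proof (induction k arbitrary: g)
  case 0
  then show ?case using assms(4) by (auto intro: continuous_on_compose2)
next
  case (Suc k)
  let ?Df = "\<lambda>x. frechet_derivative f (at x within S)"
  let ?Dg = "\<lambda>y. frechet_derivative g (at y within T)"
  have "((\<lambda>x. g (f x)) has_derivative (\<lambda>v. \<Sum>b\<in>Basis. (?Df x v \<bullet> b) *\<^sub>R ?Dg (f x) b)) (at x within S)"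
    if "x \<in> S" for x
  proof -
    have g: "(g has_derivative ?Dg (f x)) (at (f x) within T)"
      using Ck_on_Suc_has_derivative[OF Suc.prems(2)] assms(4) that by blast
    interpret bounded_linear "?Dg (f x)" using g by (rule has_derivative_bounded_linear)
    have expand: "?Dg (f x) w = (\<Sum>b\<in>Basis. (w \<bullet> b) *\<^sub>R ?Dg (f x) b)" for w
      using arg_cong[OF euclidean_representation[of w], of "?Dg (f x)"] unfolding sum scaleR by simp
    then show ?thesis
      using has_derivative_in_compose[OF Ck_on_Suc_has_derivative[OF Suc.prems(1) that]
          has_derivative_subset[OF g assms(4)]]
      by (subst (asm) expand)
  qed
  then show ?case
  proof (rule Ck_on_SucI[OF assms(1)])
    fix v
    show "Ck_on k S (\<lambda>x. \<Sum>b\<in>Basis. (?Df x v \<bullet> b) *\<^sub>R ?Dg (f x) b)"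
      using Suc.prems
      by (intro Ck_on_sum[OF assms(1)] Ck_on_bilinear[OF assms(1) bounded_bilinear_scaleR]
            Ck_on_linear[OF assms(1) bounded_linear_inner_left] Suc.IH Ck_on_SucD[OF Suc.prems(1)])
        auto
  qed
qed

text \<open>The derivative is a product of the derivative of \<open>f\<close> with two copies of the
  inverse itself; these are needed only at order \<open>k\<close>, where the induction hypothesis
  supplies them.\<close>

lemma Ck_on_inverse:
  fixes f :: "'a::euclidean_space \<Rightarrow> real"
  assumes "thick S" "Ck_on k S f" "\<And>x. x \<in> S \<Longrightarrow> f x \<noteq> 0"
  shows "Ck_on k S (\<lambda>x. inverse (f x))"
  using assms(2)
proof (induction k)
  case 0
  then show ?case using assms(3) by (auto intro!: continuous_intros)
next
  case (Suc k)
  have IH: "Ck_on k S (\<lambda>x. inverse (f x))" by (rule Suc.IH[OF Ck_on_SucD[OF Suc.prems]])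
  let ?D = "\<lambda>x. frechet_derivative f (at x within S)"
  have *: "((\<lambda>x. inverse (f x)) has_derivative (\<lambda>v. - (inverse (f x) * ?D x v * inverse (f x)))) (at x within S)"
    if "x \<in> S" for x
    by (rule Deriv.has_derivative_inverse[OF assms(3)[OF that] Ck_on_Suc_has_derivative[OF Suc.prems that]])
  show ?case
    by (rule Ck_on_SucI[OF assms(1) *])
       (use Suc.prems in \<open>auto intro!: Ck_on_linear[OF assms(1) bounded_linear_minus[OF bounded_linear_ident]] 
           Ck_on_bilinear[OF assms(1) bounded_bilinear_mult] IH\<close>)
qed

section \<open>Closure properties of smooth functions\<close>

named_theorems smooth_intros

lemma smooth_on_cong:
  assumes "\<And>x. x \<in> S \<Longrightarrow> f x = g x"
  shows "smooth_on S f \<longleftrightarrow> smooth_on S g"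
  unfolding smooth_on_def using Ck_on_cong[of S f g] assms by simp

lemma smooth_on_has_derivative:
  "smooth_on S f \<Longrightarrow> x \<in> S \<Longrightarrow> (f has_derivative frechet_derivative f (at x within S)) (at x within S)"
  by (simp add: smooth_on_def Ck_on_Suc_has_derivative)

lemma smooth_on_frechet_derivative:
  "smooth_on S f \<Longrightarrow> smooth_on S (\<lambda>x. frechet_derivative f (at x within S) v)"
  unfolding smooth_on_def by (metis Ck_on.simps(2))

lemma smooth_on_imp_continuous_on: "smooth_on S f \<Longrightarrow> continuous_on S f"
  unfolding smooth_on_def by (metis Ck_on.simps(1))

lemma smooth_on_linear:
  "thick S \<Longrightarrow> bounded_linear h \<Longrightarrow> smooth_on S f \<Longrightarrow> smooth_on S (\<lambda>x. h (f x))"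
  by (simp add: smooth_on_def Ck_on_linear)

lemma smooth_on_const [smooth_intros]: "thick S \<Longrightarrow> smooth_on S (\<lambda>x. c)"
  by (simp add: smooth_on_def Ck_on_const)

lemma smooth_on_ident [smooth_intros]:
  assumes "thick S"
  shows "smooth_on S (\<lambda>x. x)"
  unfolding smooth_on_def
proof
  fix k
  show "Ck_on k S (\<lambda>x. x)"
    by (cases k) (auto intro!: Ck_on_SucI[OF assms has_derivative_ident] Ck_on_const[OF assms] 
        simp del: Ck_on.simps(2))
qed

lemma smooth_on_add [smooth_intros]:
  "thick S \<Longrightarrow> smooth_on S f \<Longrightarrow> smooth_on S g \<Longrightarrow> smooth_on S (\<lambda>x. f x + g x)"
  by (simp add: smooth_on_def Ck_on_add)

lemma smooth_on_minus [smooth_intros]: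
  "thick S \<Longrightarrow> smooth_on S f \<Longrightarrow> smooth_on S (\<lambda>x. - f x)"
  by (rule smooth_on_linear[OF _ bounded_linear_minus[OF bounded_linear_ident]])

lemma smooth_on_diff [smooth_intros]:
  "thick S \<Longrightarrow> smooth_on S f \<Longrightarrow> smooth_on S g \<Longrightarrow> smooth_on S (\<lambda>x. f x - g x)"
  using smooth_on_add[of S f "\<lambda>x. - g x", OF _ _ smooth_on_minus[of S g]] by simp

lemma smooth_on_sum [smooth_intros]:
  "thick S \<Longrightarrow> (\<And>i. i \<in> I \<Longrightarrow> smooth_on S (f i)) \<Longrightarrow> smooth_on S (\<lambda>x. \<Sum>i\<in>I. f i x)"
  by (simp add: smooth_on_def Ck_on_sum)

lemma smooth_on_scaleR [smooth_intros]:
  "thick S \<Longrightarrow> smooth_on S f \<Longrightarrow> smooth_on S g \<Longrightarrow> smooth_on S (\<lambda>x. f x *\<^sub>R g x)"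
  by (simp add: smooth_on_def Ck_on_bilinear[OF _ bounded_bilinear_scaleR])

lemma smooth_on_mult [smooth_intros]:
  fixes f g :: "'a::euclidean_space \<Rightarrow> real"
  shows "thick S \<Longrightarrow> smooth_on S f \<Longrightarrow> smooth_on S g \<Longrightarrow> smooth_on S (\<lambda>x. f x * g x)"
  by (simp add: smooth_on_def Ck_on_bilinear[OF _ bounded_bilinear_mult])

lemma smooth_on_power [smooth_intros]:
  fixes f :: "'a::euclidean_space \<Rightarrow> real"
  shows "thick S \<Longrightarrow> smooth_on S f \<Longrightarrow> smooth_on S (\<lambda>x. f x ^ n)"
  by (induction n) (auto intro!: smooth_intros)

lemma smooth_on_prod [smooth_intros]:
  fixes f :: "'i \<Rightarrow> 'a::euclidean_space \<Rightarrow> real"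
  shows "thick S \<Longrightarrow> (\<And>i. i \<in> I \<Longrightarrow> smooth_on S (f i)) \<Longrightarrow> smooth_on S (\<lambda>x. \<Prod>i\<in>I. f i x)"
  by (induction I rule: infinite_finite_induct) (auto intro!: smooth_intros)

lemma smooth_on_divide [smooth_intros]:
  fixes f g :: "'a::euclidean_space \<Rightarrow> real"
  shows "thick S \<Longrightarrow> smooth_on S f \<Longrightarrow> smooth_on S g \<Longrightarrow> (\<And>x. x \<in> S \<Longrightarrow> g x \<noteq> 0) \<Longrightarrow>
    smooth_on S (\<lambda>x. f x / g x)"
  unfolding divide_inverse
  by (rule smooth_on_mult) (auto simp: smooth_on_def intro!: Ck_on_inverse)

lemma smooth_on_compose:
  fixes f :: "'a::euclidean_space \<Rightarrow> 'b::euclidean_space"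
  shows "smooth_on T g \<Longrightarrow> thick S \<Longrightarrow> smooth_on S f \<Longrightarrow> (\<And>x. x \<in> S \<Longrightarrow> f x \<in> T) \<Longrightarrow>
    smooth_on S (\<lambda>x. g (f x))"
  by (auto simp: smooth_on_def intro!: Ck_on_compose[of S _ f T g])

lemma smooth_on_Pair [smooth_intros]:
  assumes "thick S" "smooth_on S f" "smooth_on S g"
  shows "smooth_on S (\<lambda>x. (f x, g x))"
proof -
  have "bounded_linear (\<lambda>x. (x, 0))" "bounded_linear (\<lambda>x. (0, x))"
    by (auto intro!: bounded_linear_Pair bounded_linear_ident bounded_linear_zero)
  from smooth_on_add[OF assms(1) smooth_on_linear[OF assms(1) this(1) assms(2)]
      smooth_on_linear[OF assms(1) this(2) assms(3)]]
  show ?thesis by simp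
qed

lemma smooth_on_fst [smooth_intros]: "thick S \<Longrightarrow> smooth_on S f \<Longrightarrow> smooth_on S (\<lambda>x. fst (f x))"
  by (rule smooth_on_linear[OF _ bounded_linear_fst])

lemma smooth_on_snd [smooth_intros]: "thick S \<Longrightarrow> smooth_on S f \<Longrightarrow> smooth_on S (\<lambda>x. snd (f x))"
  by (rule smooth_on_linear[OF _ bounded_linear_snd])

lemma smooth_on_vec_nth [smooth_intros]: "thick S \<Longrightarrow> smooth_on S f \<Longrightarrow> smooth_on S (\<lambda>x. f x $ i)"
  by (rule smooth_on_linear[OF _ bounded_linear_vec_nth])

lemma smooth_on_vec_lambda [smooth_intros]:
  fixes f :: "'i::finite \<Rightarrow> 'a::euclidean_space \<Rightarrow> 'b::real_normed_vector"
  assumes "thick S" "\<And>i. smooth_on S (f i)"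
  shows "smooth_on S (\<lambda>x. \<chi> i. f i x)"
proof -
  have lin: "bounded_linear (\<lambda>y::'b. axis i y)" for i :: 'i
  proof (rule bounded_linear_intro[of _ 1])
    fix y :: 'b
    have "norm (axis i y) = sqrt (\<Sum>j\<in>UNIV. if j = i then (norm y)\<^sup>2 else 0)"
      unfolding norm_vec_def L2_set_def axis_def by (intro arg_cong[of _ _ sqrt] sum.cong) auto
    then show "norm (axis i y) \<le> norm y * 1" by simp
  qed (auto simp: vec_eq_iff axis_def)
  have "(\<chi> i. f i x) = (\<Sum>i\<in>UNIV. axis i (f i x))" for x
    by (simp add: vec_eq_iff axis_def)
  then show ?thesis
    using smooth_on_sum[OF assms(1), of UNIV "\<lambda>i x. axis i (f i x)"]
      smooth_on_linear[OF assms(1) lin assms(2)] by simp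
qed

section \<open>Smooth families of matrices and their inverses\<close>

lemma smooth_on_matrix_vector_mult [smooth_intros]:
  fixes A :: "'a::euclidean_space \<Rightarrow> real^'n^'m"
  shows "thick S \<Longrightarrow> smooth_on S A \<Longrightarrow> smooth_on S v \<Longrightarrow> smooth_on S (\<lambda>x. A x *v v x)"
  unfolding matrix_vector_mult_def by (intro smooth_intros)

lemma smooth_on_det [smooth_intros]:
  fixes A :: "'a::euclidean_space \<Rightarrow> real^'n^'n"
  shows "thick S \<Longrightarrow> smooth_on S A \<Longrightarrow> smooth_on S (\<lambda>x. det (A x))"
  unfolding det_def by (intro smooth_intros)

lemma matrix_inv_right_left:
  fixes A :: "real^'n^'n"
  assumes "invertible A"
  shows "A ** matrix_inv A = mat 1" "matrix_inv A ** A = mat 1"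
  using assms unfolding invertible_def matrix_inv_def by (rule someI2_ex, simp)+

text \<open>Cramer's rule writes the entries of the inverse as quotients of determinants, which are
  polynomials in the entries of \<Psi>, with denominator \<open>det (\<Psi> x)\<close> nonzero on
  \<open>U\<close>.\<close>

lemma smooth_on_Phi [smooth_intros]:
  fixes \<Psi> :: "real^'n \<Rightarrow> real^'n^'n"
  assumes "thick U" "smooth_on U \<Psi>" "\<And>x. x \<in> U \<Longrightarrow> invertible (\<Psi> x)"
  shows "smooth_on U (Phi \<Psi>)"
proof -
  define G :: "real^'n \<Rightarrow> real^'n^'n"
    where "G x = (\<chi> i j. det (\<chi> r s. if s = i then axis j 1 $ r else \<Psi> x $ r $ s) / det (\<Psi> x))" for x
  have "G x = Phi \<Psi> x" if x: "x \<in> U" for x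
  proof -
    have d: "det (\<Psi> x) \<noteq> 0" using assms(3)[OF x] invertible_det_nz by blast
    have "\<Psi> x *v (Phi \<Psi> x *v axis j 1) = axis j 1" for j
      by (simp add: Phi_def matrix_vector_mul_assoc matrix_inv_right_left[OF assms(3)[OF x]])
    from this[unfolded cramer[OF d]] have "(Phi \<Psi> x *v axis j 1) $ i = G x $ i $ j" for i j
      by (simp add: G_def)
    then show ?thesis
      by (simp add: vec_eq_iff matrix_vector_mult_basis column_def del: vec_lambda_eta)
  qed
  moreover have "smooth_on U G"
  proof -
    have *: "smooth_on U (\<lambda>x. if s = i then c else \<Psi> x $ r $ s)" for s i r :: 'n and c
      using assms by (cases "s = i") (auto intro!: smooth_intros)
    show ?thesis
      unfolding G_def using assms invertible_det_nz by (intro smooth_intros *) auto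
  qed
  ultimately show ?thesis using smooth_on_cong[of U G "Phi \<Psi>"] by simp
qed

lemma smooth_on_compose2:
  fixes f :: "'z::euclidean_space \<Rightarrow> 'a::euclidean_space" and g :: "'z \<Rightarrow> 'b::euclidean_space"
  assumes "smooth_on T (\<lambda>(x, y). F x y)" "thick S" "smooth_on S f" "smooth_on S g"
    "\<And>z. z \<in> S \<Longrightarrow> (f z, g z) \<in> T"
  shows "smooth_on S (\<lambda>z. F (f z) (g z))"
  using smooth_on_compose[where f = "\<lambda>z. (f z, g z)", OF assms(1,2) smooth_on_Pair[OF assms(2-4)]]
    assms(5) by simp

lemma smooth_on_compose3:
  fixes f :: "'z::euclidean_space \<Rightarrow> 'a::euclidean_space" and g :: "'z \<Rightarrow> 'b::euclidean_space"
    and h :: "'z \<Rightarrow> 'c::euclidean_space"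
  assumes "smooth_on T (\<lambda>(x, y, w). F x y w)" "thick S" "smooth_on S f" "smooth_on S g" "smooth_on S h"
    "\<And>z. z \<in> S \<Longrightarrow> (f z, g z, h z) \<in> T"
  shows "smooth_on S (\<lambda>z. F (f z) (g z) (h z))"
  using smooth_on_compose[where f = "\<lambda>z. (f z, g z, h z)", OF assms(1,2)
      smooth_on_Pair[OF assms(2,3) smooth_on_Pair[OF assms(2,4,5)]]] assms(6) by simp

section \<open>Partial derivatives\<close>

text \<open>Here \<open>e\<close> is meant to be an affine slice such as
  \<open>y -> (y, u, a)\<close>. A partial derivative in one argument becomes the total derivative
  on a fixed vector, and so is jointly smooth in all arguments. Openness turns the derivative within
  \<open>S\<close> into the two-sided one behind \<open>pd\<close>.\<close>

lemma pd_compose: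
  assumes "open S" "smooth_on S F" "e x \<in> S" "(e has_derivative e') (at x)"
  shows "pd (\<lambda>y. F (e y)) j x = frechet_derivative F (at (e x) within S) (e' (axis j 1))"
proof -
  let ?D = "frechet_derivative F (at (e x) within S)"
  have "(F has_derivative ?D) (at (e x) within S)"
    using smooth_on_has_derivative assms(2,3) .
  then have D: "(F has_derivative ?D) (at (e x))"
    unfolding at_within_open[OF assms(3,1)] .
  have "((\<lambda>y. F (e y)) has_derivative (\<lambda>h. ?D (e' h))) (at x)"
    by (rule has_derivative_compose[OF assms(4) D])
  from pd_frechet[OF this, of j] show ?thesis .
qed

lemma pd_eq_frechet_derivative:
  assumes "open S" "smooth_on S f" "x \<in> S"
  shows "pd f j x = frechet_derivative f (at x within S) (axis j 1)"
  by (rule pd_compose[where e = "\<lambda>y. y", OF assms has_derivative_ident])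

lemma smooth_on_eq_frechet_derivative:
  assumes "smooth_on S F" "\<And>z. z \<in> S \<Longrightarrow> G z = frechet_derivative F (at z within S) v"
  shows "smooth_on S G"
  by (subst smooth_on_cong[OF assms(2)]) (auto intro: smooth_on_frechet_derivative assms(1))

lemma smooth_on_pd:
  assumes "open S" "smooth_on S f"
  shows "smooth_on S (pd f j)"
  by (rule smooth_on_eq_frechet_derivative[OF assms(2) pd_eq_frechet_derivative[OF assms]])

lemma smooth_on_pd_fst:
  fixes F :: "real^'n \<Rightarrow> 'b::euclidean_space \<Rightarrow> real"
  assumes "open U" "smooth_on (U \<times> UNIV) (\<lambda>(x, v). F x v)"
  shows "smooth_on (U \<times> UNIV) (\<lambda>(x, v). pd (\<lambda>y. F y v) j x)"
proof -
  let ?F = "\<lambda>(x, v). F x v"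
  have "pd (\<lambda>y. F y v) j x = frechet_derivative ?F (at (x, v) within U \<times> UNIV) (axis j 1, 0)"
    if "x \<in> U" for x v
  proof -
    have "((\<lambda>x. (x, v)) has_derivative (\<lambda>h. (h, 0))) (at x)"
      by (auto intro!: derivative_eq_intros)
    from pd_compose[OF _ assms(2) _ this, of j] show ?thesis
      using that assms(1) by (simp add: open_Times)
  qed
  then show ?thesis
    by (intro smooth_on_eq_frechet_derivative[OF assms(2)]) auto
qed

lemma smooth_on_pd_snd:
  fixes F :: "'a::euclidean_space \<Rightarrow> real^'n \<Rightarrow> real"
  assumes "open U" "smooth_on (U \<times> UNIV) (\<lambda>(x, v). F x v)"
  shows "smooth_on (U \<times> UNIV) (\<lambda>(x, v). pd (F x) j v)"
proof -
  let ?F = "\<lambda>(x, v). F x v"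
  have "pd (F x) j v = frechet_derivative ?F (at (x, v) within U \<times> UNIV) (0, axis j 1)"
    if "x \<in> U" for x v
  proof -
    have "((\<lambda>v. (x, v)) has_derivative (\<lambda>h. (0, h))) (at v)"
      by (auto intro!: derivative_eq_intros)
    from pd_compose[OF _ assms(2) _ this, of j] show ?thesis
      using that assms(1) by (simp add: open_Times)
  qed
  then show ?thesis
    by (intro smooth_on_eq_frechet_derivative[OF assms(2)]) auto
qed

section \<open>Smoothness of the cost\<close>

lemma smooth_on_unconstr [smooth_intros]:
  assumes "thick S" "smooth_on S f"
  shows "smooth_on S (\<lambda>z. unconstr M (f z))"
proof -
  have "smooth_on S (\<lambda>z. if i \<in> M then 0 else f z $ i)" for i
    using assms by (cases "i \<in> M") (auto intro!: smooth_intros)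
  then show ?thesis unfolding unconstr_def using assms by (intro smooth_intros)
qed

lemma smooth_on_hamel:
  assumes "open U" "smooth_on U \<Psi>" "\<And>x. x \<in> U \<Longrightarrow> invertible (\<Psi> x)"
  shows "smooth_on U (\<lambda>x. hamel \<Psi> x s p r)"
  unfolding hamel_def
  using assms thick_open[OF assms(1)] by (intro smooth_intros smooth_on_pd) auto

lemma smooth_on_quasi_lagrangian:
  assumes "open U" "smooth_on U \<Psi>" "\<And>x. x \<in> U \<Longrightarrow> invertible (\<Psi> x)"
    and "smooth_on (U \<times> UNIV) (\<lambda>(x, v). L x v)"
  shows "smooth_on (U \<times> UNIV) (\<lambda>(x, u). quasi_lagrangian \<Psi> L x u)"
proof -
  have th: "thick U" "thick (U \<times> (UNIV :: (real^'a) set))"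
    using assms(1) by (auto intro: thick_open open_Times)
  have "smooth_on (U \<times> UNIV) (\<lambda>z::(real^'a) \<times> (real^'a). Phi \<Psi> (fst z))"
    by (rule smooth_on_compose[OF smooth_on_Phi]) (use th assms in \<open>auto intro!: smooth_intros\<close>)
  then show ?thesis
    unfolding quasi_lagrangian_def split_beta
    by (intro smooth_on_compose2[OF assms(4)] smooth_intros th) auto
qed

lemma smooth_on_controls:
  fixes \<Psi> :: "real^'n \<Rightarrow> real^'n^'n"
  assumes "open U" "smooth_on U \<Psi>" "\<And>x. x \<in> U \<Longrightarrow> invertible (\<Psi> x)"
    and "smooth_on (U \<times> UNIV) (\<lambda>(x, v). L x v)"
  shows "smooth_on (U \<times> UNIV \<times> UNIV) (\<lambda>(x, u, a). controls \<Psi> M L x u a)"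
proof -
  let ?Z = "U \<times> (UNIV :: (real^'n) set) \<times> (UNIV :: (real^'n) set)"
  let ?\<L> = "quasi_lagrangian \<Psi> L"
  have th: "thick U" "thick ?Z"
    using assms(1) by (auto intro: thick_open open_Times)
  note \<L> = smooth_on_quasi_lagrangian[OF assms]
  have x: "smooth_on ?Z fst" and w: "smooth_on ?Z (\<lambda>z. unconstr M (fst (snd z)))"
    using th by (auto intro!: smooth_intros)
  have u: "smooth_on ?Z (\<lambda>z. fst (snd z) $ i)" and a: "smooth_on ?Z (\<lambda>z. snd (snd z) $ i)" for i
    using th by (auto intro!: smooth_intros)
  have 1: "smooth_on ?Z (\<lambda>z. pd (\<lambda>y. pd (?\<L> y) I (unconstr M (fst (snd z)))) j (fst z))" for I j
    by (rule smooth_on_compose2[OF smooth_on_pd_fst[OF assms(1) smooth_on_pd_snd[OF assms(1) \<L>]] th(2) x w]) auto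
  have 2: "smooth_on ?Z (\<lambda>z. pd (pd (?\<L> (fst z)) I) J (unconstr M (fst (snd z))))" for I J
    by (rule smooth_on_compose2[OF smooth_on_pd_snd[OF assms(1) smooth_on_pd_snd[OF assms(1) \<L>]] th(2) x w]) auto
  have 3: "smooth_on ?Z (\<lambda>z. pd (?\<L> (fst z)) I (unconstr M (fst (snd z))))" for I
    by (rule smooth_on_compose2[OF smooth_on_pd_snd[OF assms(1) \<L>] th(2) x w]) auto
  have 4: "smooth_on ?Z (\<lambda>z. pd (\<lambda>y. ?\<L> y (unconstr M (fst (snd z)))) j (fst z))" for j
    by (rule smooth_on_compose2[OF smooth_on_pd_fst[OF assms(1) \<L>] th(2) x w]) auto
  have 5: "smooth_on ?Z (\<lambda>z. Phi \<Psi> (fst z))"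
    by (rule smooth_on_compose[OF smooth_on_Phi th(2) x]) (use th assms in auto)
  have 6: "smooth_on ?Z (\<lambda>z. hamel \<Psi> (fst z) s p r)" for s p r
    by (rule smooth_on_compose[OF smooth_on_hamel[OF assms(1-3)] th(2) x]) auto
  have "smooth_on ?Z (\<lambda>z. controls \<Psi> M L (fst z) (fst (snd z)) (snd (snd z)) $ I)" for I
  proof (cases "I \<in> M")
    case True
    then show ?thesis 
      using smooth_on_const[OF th(2)] by (simp add: controls_def Let_def)
  next
    case False
    then show ?thesis
      by (simp add: controls_def Let_def dtheta_def del: UNIV_Times_UNIV)
        (intro smooth_on_add smooth_on_diff smooth_on_sum smooth_on_mult smooth_on_vec_nth
          1 2 3 4 5 6 u a th(2))
  qed
  from smooth_on_vec_lambda[where f = "\<lambda>I z. controls \<Psi> M L (fst z) (fst (snd z)) (snd (snd z)) $ I",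
      OF th(2) this]
  show ?thesis by (simp add: case_prod_unfold)
qed

lemma smooth_on_cost:
  assumes "open U" "smooth_on U \<Psi>" "\<And>x. x \<in> U \<Longrightarrow> invertible (\<Psi> x)"
    and "smooth_on (U \<times> UNIV) (\<lambda>(x, v). L x v)"
    and "smooth_on (U \<times> UNIV \<times> UNIV) (\<lambda>(x, v, Q). g x v Q)"
  shows "smooth_on (U \<times> UNIV \<times> UNIV) (\<lambda>(x, u, a). cost \<Psi> M L g x u a)"
proof -
  let ?Z = "U \<times> (UNIV :: (real^'a) set) \<times> (UNIV :: (real^'a) set)"
  have th: "thick U" "thick ?Z"
    using assms(1) by (auto intro: thick_open open_Times)
  have x: "smooth_on ?Z fst" and w: "smooth_on ?Z (\<lambda>z. unconstr M (fst (snd z)))"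
    using th by (auto intro!: smooth_intros)
  have "smooth_on ?Z (\<lambda>z. Phi \<Psi> (fst z))"
    by (rule smooth_on_compose[OF smooth_on_Phi th(2) x]) (use th assms in auto)
  then show ?thesis
    unfolding cost_def split_beta
    using smooth_on_controls[OF assms(1-4), of M, unfolded split_beta] w x th
    by (intro smooth_on_compose3[OF assms(5)] smooth_on_matrix_vector_mult) auto
qed

lemma unconstr_idem [simp]: "unconstr M (unconstr M u) = unconstr M u"
  by (simp add: unconstr_def vec_eq_iff)

text \<open>\<open>C\<close> reads \<open>u\<close> and \<open>a\<close> only through
  \<open>unconstr\<close> or through sums over \<open>- M\<close>. In this form the independence of
  the constrained components serves as an abstract hypothesis on \<open>C\<close>, so that the
  variational argument never has to unfold \<open>cost\<close>.\<close>

lemma cost_unconstr: "cost \<Psi> M L g x (unconstr M u) (unconstr M a) = cost \<Psi> M L g x u a"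
proof -
  have unconstr: "unconstr M v $ K = v $ K" if "K \<notin> M" for v K
    using that by (simp add: unconstr_def)
  show ?thesis by (simp add: cost_def controls_def Let_def unconstr cong: sum.cong_simp if_cong)
qed

section \<open>Curves and variations\<close>

lemma at_within_Icc_nontrivial:
  fixes a b t :: real
  shows "a < b \<Longrightarrow> t \<in> {a..b} \<Longrightarrow> at t within {a..b} \<noteq> bot"
  by (simp add: trivial_limit_within islimpt_Icc)

lemma ddt_eqI:
  assumes "a < b" "t \<in> {a..b}" "(f has_vector_derivative f') (at t within {a..b})"
    "\<And>t. t \<in> {a..b} \<Longrightarrow> g t = f t"
  shows "ddt {a..b} g t = f'"
  by (rule vector_derivative_within[OF at_within_Icc_nontrivial[OF assms(1,2)]
        has_vector_derivative_transform[OF assms(2,4,3)]])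

lemma ddt_cong:
  assumes "t \<in> T" "\<And>t. t \<in> T \<Longrightarrow> f t = g t"
  shows "ddt T f t = ddt T g t"
proof -
  have "(f has_vector_derivative D) (at t within T) \<longleftrightarrow> (g has_vector_derivative D) (at t within T)" for D
    using assms by (metis has_vector_derivative_transform)
  then show ?thesis by (simp add: vector_derivative_def)
qed

lemma quasi_vel_cong:
  assumes "t \<in> T" "\<And>t. t \<in> T \<Longrightarrow> q t = r t"
  shows "quasi_vel \<Psi> T q t = quasi_vel \<Psi> T r t"
  using ddt_cong[of t T q r] assms by (simp add: quasi_vel_def)

lemma quasi_acc_cong:
  assumes "t \<in> T" "\<And>t. t \<in> T \<Longrightarrow> q t = r t"
  shows "quasi_acc \<Psi> T q t = quasi_acc \<Psi> T r t"
  unfolding quasi_acc_def using assms by (intro ddt_cong quasi_vel_cong) auto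

lemma smooth_on_has_ddt:
  assumes "a < b" "smooth_on {a..b} f" "t \<in> {a..b}"
  shows "(f has_vector_derivative ddt {a..b} f t) (at t within {a..b})"
  using smooth_on_has_derivative[OF assms(2,3)]
  by (metis differentiableI vector_derivative_works)

lemma smooth_on_ddt [smooth_intros]:
  assumes "a < b" "smooth_on {a..b} f"
  shows "smooth_on {a..b} (ddt {a..b} f)"
proof -
  have "ddt {a..b} f t = frechet_derivative f (at t within {a..b}) 1" if "t \<in> {a..b}" for t
    using thick_frechet_derivative[OF thick_interval[OF assms(1)] that
        smooth_on_has_ddt[OF assms that, unfolded has_vector_derivative_def]] by simp
  then show ?thesis
    using smooth_on_frechet_derivative[OF assms(2)] by (subst smooth_on_cong) auto
qed

lemma smooth_on_quasi_vel [smooth_intros]: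
  fixes \<Psi> :: "real^'n \<Rightarrow> real^'n^'n"
  assumes "a < b" "smooth_on U \<Psi>" "smooth_on {a..b} q" "\<And>t. t \<in> {a..b} \<Longrightarrow> q t \<in> U"
  shows "smooth_on {a..b} (quasi_vel \<Psi> {a..b} q)"
proof -
  note th = thick_interval[OF assms(1)]
  have "smooth_on {a..b} (\<lambda>t. \<Psi> (q t))"
    by (rule smooth_on_compose[OF assms(2) th assms(3,4)])
  from smooth_on_matrix_vector_mult[OF th this smooth_on_ddt[OF assms(1,3)]]
  show ?thesis unfolding quasi_vel_def .
qed

lemma smooth_on_quasi_acc [smooth_intros]:
  fixes \<Psi> :: "real^'n \<Rightarrow> real^'n^'n"
  assumes "a < b" "smooth_on U \<Psi>" "smooth_on {a..b} q" "\<And>t. t \<in> {a..b} \<Longrightarrow> q t \<in> U"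
  shows "smooth_on {a..b} (quasi_acc \<Psi> {a..b} q)"
  unfolding quasi_acc_def by (rule smooth_on_ddt[OF assms(1) smooth_on_quasi_vel[OF assms]])

section \<open>Partial and mixed derivatives on a rectangle\<close>

lemma has_derivative_partial_fst:
  assumes "(F has_derivative D) (at (s, t) within S \<times> T)" "t \<in> T"
  shows "((\<lambda>s. F (s, t)) has_vector_derivative D (1, 0)) (at s within S)"
proof -
  interpret bounded_linear D using assms(1) by (rule has_derivative_bounded_linear)
  have "((\<lambda>s. (s, t)) has_derivative (\<lambda>h. (h, 0))) (at s within S)"
    by (auto intro!: derivative_eq_intros)
  from has_derivative_in_compose[OF this has_derivative_subset[OF assms(1)]]
  have "((\<lambda>s. F (s, t)) has_derivative (\<lambda>h. D (h, 0))) (at s within S)"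
    using assms(2) by auto
  moreover have "(\<lambda>h. D (h, 0)) = (\<lambda>h. h *\<^sub>R D (1, 0))"
    unfolding scaleR[symmetric] by simp
  ultimately show ?thesis unfolding has_vector_derivative_def by (simp only:)
qed

lemma has_derivative_partial_snd:
  assumes "(F has_derivative D) (at (s, t) within S \<times> T)" "s \<in> S"
  shows "((\<lambda>t. F (s, t)) has_vector_derivative D (0, 1)) (at t within T)"
proof -
  interpret bounded_linear D using assms(1) by (rule has_derivative_bounded_linear)
  have "((\<lambda>t. (s, t)) has_derivative (\<lambda>h. (0, h))) (at t within T)"
    by (auto intro!: derivative_eq_intros)
  from has_derivative_in_compose[OF this has_derivative_subset[OF assms(1)]]
  have "((\<lambda>t. F (s, t)) has_derivative (\<lambda>h. D (0, h))) (at t within T)"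
    using assms(2) by auto
  moreover have "(\<lambda>h. D (0, h)) = (\<lambda>h. h *\<^sub>R D (0, 1))"
    unfolding scaleR[symmetric] by simp
  ultimately show ?thesis unfolding has_vector_derivative_def by (simp only:)
qed

lemma smooth_on_partial_fst:
  assumes "smooth_on (S \<times> T) F" "s \<in> S" "t \<in> T"
  shows "((\<lambda>s. F (s, t)) has_vector_derivative frechet_derivative F (at (s, t) within S \<times> T) (1, 0))
    (at s within S)"
  by (rule has_derivative_partial_fst[OF smooth_on_has_derivative[OF assms(1)]]) (use assms in auto)

lemma smooth_on_partial_snd:
  assumes "smooth_on (S \<times> T) F" "s \<in> S" "t \<in> T"
  shows "((\<lambda>t. F (s, t)) has_vector_derivative frechet_derivative F (at (s, t) within S \<times> T) (0, 1))
    (at t within T)"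
  by (rule has_derivative_partial_snd[OF smooth_on_has_derivative[OF assms(1)]]) (use assms in auto)

text \<open>Differentiating the fundamental theorem of calculus in the parameter \<open>s\<close> avoids second
  differences, and hence also works on the boundary of the rectangle.\<close>

lemma smooth_on_mixed_derivative:
  fixes F :: "real \<times> real \<Rightarrow> 'b::euclidean_space" and a b c d :: real
  defines "R \<equiv> {c..d} \<times> {a..b}"
  assumes cd: "c < d" and ab: "a < b" and F: "smooth_on R F" and s: "s \<in> {c..d}" and t: "t \<in> {a..b}"
  shows "((\<lambda>t. frechet_derivative F (at (s, t) within R) (1, 0)) has_vector_derivative
    frechet_derivative (\<lambda>z. frechet_derivative F (at z within R) (0, 1)) (at (s, t) within R) (1, 0))
    (at t within {a..b})"
proof -
  define Ft where "Ft z = frechet_derivative F (at z within R) (0, 1)" for z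
  define Fs where "Fs z = frechet_derivative F (at z within R) (1, 0)" for z
  define Fts where "Fts z = frechet_derivative Ft (at z within R) (1, 0)" for z
  have smooth: "smooth_on R Ft" "smooth_on R Fs"
    unfolding Ft_def Fs_def by (rule smooth_on_frechet_derivative[OF F])+
  have "smooth_on R Fts"
    unfolding Fts_def by (rule smooth_on_frechet_derivative[OF smooth(1)])
  note cont = smooth_on_imp_continuous_on[OF smooth(1)] smooth_on_imp_continuous_on[OF this]
  have dFs: "((\<lambda>s. F (s, t)) has_vector_derivative Fs (s, t)) (at s within {c..d})"
    and dFt: "((\<lambda>t. F (s, t)) has_vector_derivative Ft (s, t)) (at t within {a..b})"
    and dFts: "((\<lambda>s. Ft (s, t)) has_vector_derivative Fts (s, t)) (at s within {c..d})"
    if "s \<in> {c..d}" "t \<in> {a..b}" for s t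
    using smooth_on_partial_fst[OF F[unfolded R_def] that] smooth_on_partial_snd[OF F[unfolded R_def] that]
      smooth_on_partial_fst[OF smooth(1)[unfolded R_def] that]
    by (simp_all only: Fs_def Ft_def Fts_def R_def)
  have int: "(\<lambda>t. Fts (s, t)) integrable_on {a..b}"
    by (intro integrable_continuous_interval continuous_on_compose2[OF cont(2)])
      (use s in \<open>auto simp: R_def intro!: continuous_intros\<close>)
  have eq: "Fs (s, t) = Fs (s, a) + integral {a..t} (\<lambda>\<tau>. Fts (s, \<tau>))" if t: "t \<in> {a..b}" for t
  proof -
    have ftc: "integral {a..t} (\<lambda>\<tau>. Ft (r, \<tau>)) = F (r, t) - F (r, a)" if r: "r \<in> {c..d}" for r
    proof -
      have "((\<lambda>\<tau>. F (r, \<tau>)) has_vector_derivative Ft (r, \<tau>)) (at \<tau> within {a..t})"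
        if "\<tau> \<in> {a..t}" for \<tau>
        using dFt[OF r, of \<tau>] that t by (auto intro: has_vector_derivative_within_subset)
      from fundamental_theorem_of_calculus[OF _ this] t show ?thesis
        by (auto intro: integral_unique)
    qed
    have "((\<lambda>r. integral (cbox a t) (\<lambda>\<tau>. Ft (r, \<tau>))) has_vector_derivative
        integral (cbox a t) (\<lambda>\<tau>. Fts (s, \<tau>))) (at s within {c..d})"
    proof (rule leibniz_rule_vector_derivative[OF _ _ _ s])
      show "((\<lambda>r. Ft (r, \<tau>)) has_vector_derivative Fts (r, \<tau>)) (at r within {c..d})"
        if "r \<in> {c..d}" "\<tau> \<in> cbox a t" for r \<tau>
        using dFts that t by auto
      show "(\<lambda>\<tau>. Ft (r, \<tau>)) integrable_on cbox a t" if "r \<in> {c..d}" for r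
        by (intro integrable_continuous continuous_on_compose2[OF cont(1)])
          (use that t in \<open>auto simp: R_def intro!: continuous_intros\<close>)
      show "continuous_on ({c..d} \<times> cbox a t) (\<lambda>(r, \<tau>). Fts (r, \<tau>))"
        using t by (auto simp: R_def intro!: continuous_on_subset[OF cont(2)])
    qed simp
    \<comment> \<open>By \<open>ftc\<close> the same integral is a difference of two values of
      \<open>F\<close>, so its derivative in \<open>r\<close> can also be read off termwise.
      Uniqueness of the derivative equates the two results.\<close>
    moreover have "((\<lambda>r. integral (cbox a t) (\<lambda>\<tau>. Ft (r, \<tau>))) has_vector_derivative
        Fs (s, t) - Fs (s, a)) (at s within {c..d})"
      by (rule has_vector_derivative_transform[OF s _ has_vector_derivative_diff[OF dFs dFs]])
        (use s t ab ftc in auto)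
    ultimately show ?thesis
      using vector_derivative_unique_within[OF at_within_Icc_nontrivial[OF cd s]]
      by (fastforce simp: algebra_simps)
  qed
  \<comment> \<open>Now \<open>Fs (s, t)\<close> is a constant plus an integral with continuous
    integrand, so it is differentiable in \<open>t\<close> although only \<open>Ft\<close> was ever
    differentiated in \<open>s\<close>.\<close>
  have "continuous_on {a..b} (\<lambda>\<tau>. Fts (s, \<tau>))"
    by (intro continuous_on_compose2[OF cont(2)])
      (use s in \<open>auto simp: R_def intro!: continuous_intros\<close>)
  from integral_has_vector_derivative[OF this t]
  have "((\<lambda>t. Fs (s, a) + integral {a..t} (\<lambda>\<tau>. Fts (s, \<tau>))) has_vector_derivative Fts (s, t)) (at t within {a..b})"
    by (auto intro!: derivative_eq_intros)
  from has_vector_derivative_transform[OF t eq this] show ?thesis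
    unfolding Fs_def Fts_def Ft_def[abs_def] .
qed

section \<open>The first variation\<close>

lemma bounded_bilinear_matrix_vector_mult:
  "bounded_bilinear (\<lambda>(A :: real^'n^'m) v. A *v v)"
  unfolding bilinear_conv_bounded_bilinear[symmetric] bilinear_def linear_iff
  by (simp add: matrix_vector_mult_add_rdistrib matrix_vector_right_distrib
      matrix_vector_mult_scaleR scaleR_matrix_vector_assoc)

lemma bounded_linear_axis_expansion:
  fixes F :: "real^'n \<Rightarrow> real"
  assumes "bounded_linear F"
  shows "F h = (\<Sum>j\<in>UNIV. F (axis j 1) * h $ j)"
proof -
  interpret F: bounded_linear F by fact
  have "F h = F (\<Sum>j\<in>UNIV. h $ j *\<^sub>R axis j 1)"
    using basis_expansion[of h] by (simp only: scalar_mult_eq_scaleR)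
  then show ?thesis by (simp only: F.sum F.scaleR real_scaleR_def mult.commute)
qed

lemma Phi_Psi_mult:
  fixes \<Psi> :: "real^'n \<Rightarrow> real^'n^'n"
  assumes "invertible (\<Psi> x)"
  shows "Phi \<Psi> x *v (\<Psi> x *v v) = v" "\<Psi> x *v (Phi \<Psi> x *v v) = v"
  by (simp_all add: Phi_def matrix_vector_mul_assoc matrix_inv_right_left[OF assms])

lemma sum_swap_pairs:
  "(\<Sum>p\<in>A. \<Sum>r\<in>B. \<Sum>i\<in>C. \<Sum>k\<in>D. f p r i k) = (\<Sum>i\<in>C. \<Sum>k\<in>D. \<Sum>p\<in>A. \<Sum>r\<in>B. f p r i k)"
proof -
  have "(\<Sum>p\<in>A. \<Sum>r\<in>B. \<Sum>i\<in>C. \<Sum>k\<in>D. f p r i k) = (\<Sum>p\<in>A. \<Sum>i\<in>C. \<Sum>k\<in>D. \<Sum>r\<in>B. f p r i k)"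
    by (intro sum.cong refl, subst sum.swap, intro sum.cong refl, rule sum.swap)
  also have "\<dots> = (\<Sum>i\<in>C. \<Sum>k\<in>D. \<Sum>p\<in>A. \<Sum>r\<in>B. f p r i k)"
    by (subst sum.swap, intro sum.cong refl, rule sum.swap)
  finally show ?thesis .
qed

text \<open>Contracting the lower indices with vectors of the form \<open>\<Psi> x *v v\<close>
  cancels both factors \<open>Phi\<close>. What remains is the exterior derivative of the one-form
  given by row \<open>s\<close> of \<Psi>, evaluated on \<open>w\<close> and \<open>v\<close> in
  coordinates.\<close>

lemma sum_hamel:
  fixes \<Psi> :: "real^'n \<Rightarrow> real^'n^'n"
  assumes "invertible (\<Psi> x)"
  shows "(\<Sum>p\<in>UNIV. \<Sum>r\<in>UNIV. hamel \<Psi> x s p r * (\<Psi> x *v v) $ p * (\<Psi> x *v w) $ r) =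
    (\<Sum>i\<in>UNIV. \<Sum>j\<in>UNIV. (pd (\<lambda>y. \<Psi> y $ s $ i) j x - pd (\<lambda>y. \<Psi> y $ s $ j) i x) * v $ i * w $ j)"
proof -
  let ?c = "\<lambda>i j. pd (\<lambda>y. \<Psi> y $ s $ i) j x - pd (\<lambda>y. \<Psi> y $ s $ j) i x"
  let ?\<Phi> = "Phi \<Psi> x" and ?v = "\<Psi> x *v v" and ?w = "\<Psi> x *v w"
  have v: "v $ i = (\<Sum>p\<in>UNIV. ?\<Phi> $ i $ p * ?v $ p)" and w: "w $ i = (\<Sum>p\<in>UNIV. ?\<Phi> $ i $ p * ?w $ p)" for i
    using arg_cong[OF Phi_Psi_mult(1)[where \<Psi> = \<Psi> and x = x, OF assms], of "\<lambda>z. z $ i"]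
    by (simp_all add: matrix_vector_mult_def[of ?\<Phi>])
  have "(\<Sum>p\<in>UNIV. \<Sum>r\<in>UNIV. hamel \<Psi> x s p r * ?v $ p * ?w $ r) =
      (\<Sum>p\<in>UNIV. \<Sum>r\<in>UNIV. \<Sum>i\<in>UNIV. \<Sum>j\<in>UNIV. ?c i j * ((?\<Phi> $ i $ p * ?v $ p) * (?\<Phi> $ j $ r * ?w $ r)))"
    unfolding hamel_def sum_distrib_right by (intro sum.cong refl) (simp only: mult_ac)
  also have "\<dots> = (\<Sum>i\<in>UNIV. \<Sum>j\<in>UNIV. \<Sum>p\<in>UNIV. \<Sum>r\<in>UNIV. ?c i j * ((?\<Phi> $ i $ p * ?v $ p) * (?\<Phi> $ j $ r * ?w $ r)))"
    by (rule sum_swap_pairs)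
  also have "\<dots> = (\<Sum>i\<in>UNIV. \<Sum>j\<in>UNIV. ?c i j * (v $ i * w $ j))"
  proof (intro sum.cong refl)
    fix i j
    have "v $ i * w $ j = (\<Sum>p\<in>UNIV. \<Sum>r\<in>UNIV. (?\<Phi> $ i $ p * ?v $ p) * (?\<Phi> $ j $ r * ?w $ r))"
      by (subst v, subst w, rule sum_product)
    then show "(\<Sum>p\<in>UNIV. \<Sum>r\<in>UNIV. ?c i j * ((?\<Phi> $ i $ p * ?v $ p) * (?\<Phi> $ j $ r * ?w $ r))) =
        ?c i j * (v $ i * w $ j)"
      by (simp only: sum_distrib_left)
  qed
  finally show ?thesis by (simp only: mult.assoc)
qed

text \<open>With \<open>v\<close> the velocity and \<open>w\<close> the variation, the left side is
  the part of the variation of \<open>u\<close> that comes from varying \<Psi>, and the first term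
  on the right is the part of the time derivative of \<open>\<Psi> w\<close> that comes from moving
  \<Psi>. The remaining term, \<Psi> times the mixed derivative of the curve, is common to both and
  cancels.\<close>

lemma transpositional_relation:
  fixes \<Psi> :: "real^'n \<Rightarrow> real^'n^'n"
  assumes "invertible (\<Psi> x)" and D: "(\<Psi> has_derivative D) (at x)"
  shows "(D w *v v) $ s = (D v *v w) $ s +
    (\<Sum>p\<in>UNIV. \<Sum>r\<in>UNIV. hamel \<Psi> x s p r * (\<Psi> x *v v) $ p * (\<Psi> x *v w) $ r)"
proof -
  have entry: "bounded_linear (\<lambda>A :: real^'n^'n. A $ s $ i)" for i
    using bounded_linear_compose[OF bounded_linear_vec_nth bounded_linear_vec_nth] .
  have pd: "pd (\<lambda>y. \<Psi> y $ s $ i) j x = D (axis j 1) $ s $ i" for i j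
    by (rule pd_frechet[OF bounded_linear.has_derivative[OF entry D]])
  have DE: "D h $ s $ i = (\<Sum>j\<in>UNIV. pd (\<lambda>y. \<Psi> y $ s $ i) j x * h $ j)" for h i
    unfolding pd
    by (rule bounded_linear_axis_expansion[OF bounded_linear_compose[OF entry
          has_derivative_bounded_linear[OF D]]])
  have 1: "(D w *v v) $ s = (\<Sum>i\<in>UNIV. \<Sum>j\<in>UNIV. pd (\<lambda>y. \<Psi> y $ s $ i) j x * v $ i * w $ j)"
    by (simp add: matrix_vector_mult_def DE sum_distrib_left sum_distrib_right mult_ac)
  have "(D v *v w) $ s = (\<Sum>j\<in>UNIV. \<Sum>i\<in>UNIV. pd (\<lambda>y. \<Psi> y $ s $ j) i x * v $ i * w $ j)"
    by (simp add: matrix_vector_mult_def DE sum_distrib_right)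
  also have "\<dots> = (\<Sum>i\<in>UNIV. \<Sum>j\<in>UNIV. pd (\<lambda>y. \<Psi> y $ s $ j) i x * v $ i * w $ j)"
    by (rule sum.swap)
  finally show ?thesis
    unfolding 1 sum_hamel[of \<Psi> x, OF assms(1)] by (simp add: left_diff_distrib sum_subtractf)
qed

lemma pd_unconstrained:
  assumes "\<And>v. F (unconstr M v) = F v" "i \<in> M"
  shows "pd F i v = 0"
proof -
  have "unconstr M (v + h *\<^sub>R axis i 1) = unconstr M v" for h
    using assms(2) by (auto simp: unconstr_def vec_eq_iff axis_def)
  then have "F (v + h *\<^sub>R axis i 1) = F v" for h
    using assms(1)[of v] assms(1)[of "v + h *\<^sub>R axis i 1"] by simp
  then show ?thesis by (simp add: pd_def)
qed

section \<open>Partial derivatives of the cost integrand\<close>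

lemma pd_cost:
  fixes C :: "real^'n \<Rightarrow> real^'n \<Rightarrow> real^'n \<Rightarrow> real" and u a :: "real^'n"
  assumes "open U" "x \<in> U" and C: "smooth_on (U \<times> UNIV \<times> UNIV) (\<lambda>(x, u, a). C x u a)"
  defines "D \<equiv> frechet_derivative (\<lambda>(x, u, a). C x u a) (at (x, u, a) within U \<times> UNIV \<times> UNIV)"
  shows "pd (\<lambda>y. C y u a) j x = D (axis j 1, 0, 0)"
    and "pd (\<lambda>v. C x v a) j u = D (0, axis j 1, 0)"
    and "pd (C x u) j a = D (0, 0, axis j 1)"
proof -
  have op: "open (U \<times> (UNIV :: (real^'n) set) \<times> (UNIV :: (real^'n) set))"
    using assms(1) by (intro open_Times) auto
  have e: "((\<lambda>y. (y, u, a)) has_derivative (\<lambda>h. (h, 0, 0))) (at x)"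
    "((\<lambda>v. (x, v, a)) has_derivative (\<lambda>h. (0, h, 0))) (at u)"
    "((\<lambda>w. (x, u, w)) has_derivative (\<lambda>h. (0, 0, h))) (at a)"
    by (auto intro!: derivative_eq_intros simp: zero_prod_def)
  show "pd (\<lambda>y. C y u a) j x = D (axis j 1, 0, 0)"
    "pd (\<lambda>v. C x v a) j u = D (0, axis j 1, 0)"
    "pd (C x u) j a = D (0, 0, axis j 1)"
    using pd_compose[OF op C _ e(1), of j] pd_compose[OF op C _ e(2), of j]
      pd_compose[OF op C _ e(3), of j] assms(2) by (simp_all add: D_def)
qed

lemma smooth_on_pd_cost:
  fixes C :: "real^'n \<Rightarrow> real^'n \<Rightarrow> real^'n \<Rightarrow> real"
  assumes "open U" and C: "smooth_on (U \<times> UNIV \<times> UNIV) (\<lambda>(x, u, a). C x u a)"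
  shows "smooth_on (U \<times> UNIV \<times> UNIV) (\<lambda>(x, u, a). pd (\<lambda>y. C y u a) j x)"
    and "smooth_on (U \<times> UNIV \<times> UNIV) (\<lambda>(x, u, a). pd (\<lambda>v. C x v a) j u)"
    and "smooth_on (U \<times> UNIV \<times> UNIV) (\<lambda>(x, u, a). pd (C x u) j a)"
proof -
  show "smooth_on (U \<times> UNIV \<times> UNIV) (\<lambda>(x, u, a). pd (\<lambda>y. C y u a) j x)"
    by (rule smooth_on_eq_frechet_derivative[OF C, of _ "(axis j 1, 0, 0)"])
      (auto simp: pd_cost(1)[OF assms(1) _ C] simp del: UNIV_Times_UNIV)
  show "smooth_on (U \<times> UNIV \<times> UNIV) (\<lambda>(x, u, a). pd (\<lambda>v. C x v a) j u)"
    by (rule smooth_on_eq_frechet_derivative[OF C, of _ "(0, axis j 1, 0)"])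
      (auto simp: pd_cost(2)[OF assms(1) _ C] simp del: UNIV_Times_UNIV)
  show "smooth_on (U \<times> UNIV \<times> UNIV) (\<lambda>(x, u, a). pd (C x u) j a)"
    by (rule smooth_on_eq_frechet_derivative[OF C, of _ "(0, 0, axis j 1)"])
      (auto simp: pd_cost(3)[OF assms(1) _ C] simp del: UNIV_Times_UNIV)
qed

text \<open>Linearity would give sums over all indices. The invariance of \<open>C\<close> under
  \<open>unconstr\<close> kills the partial derivatives in directions from \<open>M\<close>, which
  is what leaves those directions to the multipliers.\<close>

lemma frechet_derivative_cost_expansion:
  fixes C :: "real^'n \<Rightarrow> real^'n \<Rightarrow> real^'n \<Rightarrow> real"
  assumes "open U" "x \<in> U"
    and C: "smooth_on (U \<times> UNIV \<times> UNIV) (\<lambda>(x, u, a). C x u a)"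
    and unconstr: "\<And>x u a. C x (unconstr M u) (unconstr M a) = C x u a"
  shows "frechet_derivative (\<lambda>(x, u, a). C x u a) (at (x, u, a) within U \<times> UNIV \<times> UNIV) (\<xi>, \<upsilon>, \<alpha>) =
    (\<Sum>j\<in>UNIV. pd (\<lambda>y. C y u a) j x * \<xi> $ j) + (\<Sum>J\<in>- M. pd (\<lambda>v. C x v a) J u * \<upsilon> $ J)
      + (\<Sum>J\<in>- M. pd (C x u) J a * \<alpha> $ J)"
proof -
  let ?D = "frechet_derivative (\<lambda>(x, u, a). C x u a) (at (x, u, a) within U \<times> UNIV \<times> UNIV)"
  note pd = pd_cost[OF assms(1,2) C, where u = u and a = a]
  have D: "bounded_linear ?D"
    by (rule has_derivative_bounded_linear[OF smooth_on_has_derivative[OF C]]) (use assms(2) in simp)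
  have lin: "bounded_linear (\<lambda>h. ?D (h, 0, 0))" "bounded_linear (\<lambda>h. ?D (0, h, 0))"
    "bounded_linear (\<lambda>h. ?D (0, 0, h))"
    by (intro bounded_linear_compose[OF D] bounded_linear_Pair bounded_linear_ident
        bounded_linear_zero)+
  \<comment> \<open>The hypothesis projects both arguments at once; idempotence of
    \<open>unconstr\<close> splits it into an invariance in each argument separately, as partial
    derivatives require.\<close>
  have "C x (unconstr M v) w = C x v w" "C x v (unconstr M w) = C x v w" for v w
    using unconstr[of x "unconstr M v" w] unconstr[of x v "unconstr M w"] unconstr[of x v w] by simp_all
  then have zero: "pd (\<lambda>v. C x v a) J u = 0" "pd (C x u) J a = 0" if "J \<in> M" for J
    using that by (auto intro!: pd_unconstrained[where M = M])
  interpret D: bounded_linear ?D by (rule D)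
  have "?D (\<xi>, \<upsilon>, \<alpha>) = ?D (\<xi>, 0, 0) + ?D (0, \<upsilon>, 0) + ?D (0, 0, \<alpha>)"
    unfolding D.add[symmetric] by simp
  also have "?D (\<xi>, 0, 0) = (\<Sum>j\<in>UNIV. pd (\<lambda>y. C y u a) j x * \<xi> $ j)"
    unfolding pd by (rule bounded_linear_axis_expansion[OF lin(1)])
  also have "?D (0, \<upsilon>, 0) = (\<Sum>J\<in>UNIV. pd (\<lambda>v. C x v a) J u * \<upsilon> $ J)"
    unfolding pd by (rule bounded_linear_axis_expansion[OF lin(2)])
  also have "\<dots> = (\<Sum>J\<in>- M. pd (\<lambda>v. C x v a) J u * \<upsilon> $ J)"
    by (rule sum.mono_neutral_right) (auto simp: zero)
  also have "?D (0, 0, \<alpha>) = (\<Sum>J\<in>UNIV. pd (C x u) J a * \<alpha> $ J)"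
    unfolding pd by (rule bounded_linear_axis_expansion[OF lin(3)])
  also have "\<dots> = (\<Sum>J\<in>- M. pd (C x u) J a * \<alpha> $ J)"
    by (rule sum.mono_neutral_right) (auto simp: zero)
  finally show ?thesis .
qed

text \<open>The multiplier of every quasi-velocity variation after integration by parts:
  \<open>\<kappa>\<close> plays for the unconstrained directions the role of \<open>\<mu>\<close> for the constrained ones.\<close>

definition costate ::
  "(real^'n \<Rightarrow> real^'n^'n) \<Rightarrow> 'n set \<Rightarrow> (real^'n \<Rightarrow> real^'n \<Rightarrow> real^'n \<Rightarrow> real) \<Rightarrow> real set
    \<Rightarrow> (real \<Rightarrow> real^'n) \<Rightarrow> ('n \<Rightarrow> real \<Rightarrow> real) \<Rightarrow> 'n \<Rightarrow> real \<Rightarrow> real" where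
  "costate \<Psi> M C T q \<mu> j = (if j \<in> M then \<mu> j else kappa \<Psi> C T q j)"

text \<open>The sum over \<open>p\<close> includes the constrained quasi-velocities, because their
  vanishing is itself one of the conditions to be derived.\<close>

definition euler_lagrange ::
  "(real^'n \<Rightarrow> real^'n^'n) \<Rightarrow> 'n set \<Rightarrow> (real^'n \<Rightarrow> real^'n \<Rightarrow> real^'n \<Rightarrow> real) \<Rightarrow> real set
    \<Rightarrow> (real \<Rightarrow> real^'n) \<Rightarrow> ('n \<Rightarrow> real \<Rightarrow> real) \<Rightarrow> 'n \<Rightarrow> real \<Rightarrow> real" where
  "euler_lagrange \<Psi> M C T q \<mu> r t =
     dtheta \<Psi> (\<lambda>x. C x (quasi_vel \<Psi> T q t) (quasi_acc \<Psi> T q t)) r (q t)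
     - ddt T (costate \<Psi> M C T q \<mu> r) t
     + (\<Sum>j\<in>UNIV. \<Sum>p\<in>UNIV. costate \<Psi> M C T q \<mu> j t * hamel \<Psi> (q t) j p r * quasi_vel \<Psi> T q t $ p)"

section \<open>Integration by parts\<close>

text \<open>Pointwise core of both integrations by parts, with primes and \<alpha> (the rate of
  \<upsilon>) standing for time derivatives: the right side is the product-rule expansion of the
  derivative of \<open>A \<upsilon> + l \<eta>\<close>. The proof evaluates the sum of
  \<open>l j * \<upsilon> j\<close> in two ways, once by splitting the indices along the definition
  of \<open>l\<close>, once by inserting the transpositional relation.\<close>

lemma by_parts_algebra:
  fixes A A' Cu \<alpha> \<upsilon> \<mu> l l' \<theta> \<eta> \<eta>' u :: "'n::finite \<Rightarrow> real"
  assumes "\<And>j. \<upsilon> j = \<eta>' j + (\<Sum>p\<in>UNIV. \<Sum>r\<in>UNIV. \<gamma> j p r * u p * \<eta> r)"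
    and "\<And>j. l j = (if j \<in> M then \<mu> j else Cu j - A' j)"
  shows "(\<Sum>r\<in>UNIV. \<theta> r * \<eta> r) + (\<Sum>J\<in>- M. Cu J * \<upsilon> J) + (\<Sum>J\<in>- M. A J * \<alpha> J) + (\<Sum>\<sigma>\<in>M. \<mu> \<sigma> * \<upsilon> \<sigma>)
      - (\<Sum>r\<in>UNIV. (\<theta> r - l' r + (\<Sum>j\<in>UNIV. \<Sum>p\<in>UNIV. l j * \<gamma> j p r * u p)) * \<eta> r)
    = (\<Sum>J\<in>- M. A' J * \<upsilon> J + A J * \<alpha> J) + (\<Sum>j\<in>UNIV. l' j * \<eta> j + l j * \<eta>' j)"
proof -
  have "(\<Sum>j\<in>UNIV. l j * \<upsilon> j) = (\<Sum>\<sigma>\<in>M. l \<sigma> * \<upsilon> \<sigma>) + (\<Sum>J\<in>- M. l J * \<upsilon> J)"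
    using sum.union_disjoint[of M "- M" "\<lambda>j. l j * \<upsilon> j"] by simp
  also have "\<dots> = (\<Sum>\<sigma>\<in>M. \<mu> \<sigma> * \<upsilon> \<sigma>) + (\<Sum>J\<in>- M. Cu J * \<upsilon> J - A' J * \<upsilon> J)"
    by (intro arg_cong2[of _ _ _ _ "(+)"] sum.cong) (auto simp: assms(2) left_diff_distrib)
  finally have 1: "(\<Sum>j\<in>UNIV. l j * \<upsilon> j) = \<dots>" .
  have "(\<Sum>j\<in>UNIV. l j * \<upsilon> j) = (\<Sum>j\<in>UNIV. l j * \<eta>' j)
      + (\<Sum>j\<in>UNIV. \<Sum>p\<in>UNIV. \<Sum>r\<in>UNIV. l j * \<gamma> j p r * u p * \<eta> r)"
    unfolding assms(1) by (simp add: distrib_left sum.distrib sum_distrib_left mult_ac)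
  also have "(\<Sum>j\<in>UNIV. \<Sum>p\<in>UNIV. \<Sum>r\<in>UNIV. l j * \<gamma> j p r * u p * \<eta> r) =
      (\<Sum>r\<in>UNIV. \<Sum>j\<in>UNIV. \<Sum>p\<in>UNIV. l j * \<gamma> j p r * u p * \<eta> r)"
  proof -
    have "(\<Sum>j\<in>UNIV. \<Sum>p\<in>UNIV. \<Sum>r\<in>UNIV. l j * \<gamma> j p r * u p * \<eta> r) =
        (\<Sum>j\<in>UNIV. \<Sum>r\<in>UNIV. \<Sum>p\<in>UNIV. l j * \<gamma> j p r * u p * \<eta> r)"
      by (intro sum.cong refl sum.swap)
    also have "\<dots> = (\<Sum>r\<in>UNIV. \<Sum>j\<in>UNIV. \<Sum>p\<in>UNIV. l j * \<gamma> j p r * u p * \<eta> r)"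
      by (rule sum.swap)
    finally show ?thesis .
  qed
  finally have 2: "(\<Sum>j\<in>UNIV. l j * \<upsilon> j) = (\<Sum>j\<in>UNIV. l j * \<eta>' j)
      + (\<Sum>r\<in>UNIV. \<Sum>j\<in>UNIV. \<Sum>p\<in>UNIV. l j * \<gamma> j p r * u p * \<eta> r)" .
  show ?thesis
    using 1 2 by (simp add: distrib_right left_diff_distrib sum.distrib sum_subtractf sum_distrib_right)
qed

text \<open>The pairing of a differential with a tangent vector does not depend on the frame:
  \<open>Phi\<close> inside \<open>dtheta\<close> cancels \<Psi>.\<close>

lemma sum_dtheta:
  fixes \<Psi> :: "real^'n \<Rightarrow> real^'n^'n"
  assumes "invertible (\<Psi> x)"
  shows "(\<Sum>r\<in>UNIV. dtheta \<Psi> F r x * (\<Psi> x *v \<xi>) $ r) = (\<Sum>j\<in>UNIV. pd F j x * \<xi> $ j)"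
proof -
  let ?\<Phi> = "Phi \<Psi> x" and ?\<eta> = "\<Psi> x *v \<xi>"
  have \<xi>: "\<xi> $ j = (\<Sum>r\<in>UNIV. ?\<Phi> $ j $ r * ?\<eta> $ r)" for j
    using arg_cong[OF Phi_Psi_mult(1)[where \<Psi> = \<Psi> and x = x, OF assms], of "\<lambda>z. z $ j"]
    by (simp add: matrix_vector_mult_def[of ?\<Phi>])
  have "(\<Sum>r\<in>UNIV. dtheta \<Psi> F r x * ?\<eta> $ r) = (\<Sum>r\<in>UNIV. \<Sum>j\<in>UNIV. pd F j x * (?\<Phi> $ j $ r * ?\<eta> $ r))"
    unfolding dtheta_def sum_distrib_right by (intro sum.cong refl) (simp only: mult_ac)
  also have "\<dots> = (\<Sum>j\<in>UNIV. pd F j x * \<xi> $ j)"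
    unfolding \<xi> sum_distrib_left by (rule sum.swap)
  finally show ?thesis .
qed

lemma smooth_on_costate:
  fixes \<Psi> :: "real^'n \<Rightarrow> real^'n^'n"
  assumes "open U" and ab: "a < b" and \<Psi>: "smooth_on U \<Psi>"
    and C: "smooth_on (U \<times> UNIV \<times> UNIV) (\<lambda>(x, u, a). C x u a)"
    and q: "smooth_on {a..b} q" "\<And>t. t \<in> {a..b} \<Longrightarrow> q t \<in> U"
    and \<mu>: "\<And>\<sigma>. \<sigma> \<in> M \<Longrightarrow> smooth_on {a..b} (\<mu> \<sigma>)"
  shows "smooth_on {a..b} (\<lambda>t. pd (C (q t) (quasi_vel \<Psi> {a..b} q t)) j (quasi_acc \<Psi> {a..b} q t))"
    and "smooth_on {a..b} (costate \<Psi> M C {a..b} q \<mu> j)"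
proof -
  note th = thick_interval[OF ab]
  note u = smooth_on_quasi_vel[OF ab \<Psi> q] and acc = smooth_on_quasi_acc[OF ab \<Psi> q]
  show 1: "smooth_on {a..b} (\<lambda>t. pd (C (q t) (quasi_vel \<Psi> {a..b} q t)) j (quasi_acc \<Psi> {a..b} q t))" for j
    by (rule smooth_on_compose3[OF smooth_on_pd_cost(3)[OF assms(1) C] th q(1) u acc]) (use q in auto)
  have "smooth_on {a..b} (\<lambda>t. pd (\<lambda>v. C (q t) v (quasi_acc \<Psi> {a..b} q t)) j (quasi_vel \<Psi> {a..b} q t))"
    by (rule smooth_on_compose3[OF smooth_on_pd_cost(2)[OF assms(1) C] th q(1) u acc]) (use q in auto)
  from smooth_on_diff[OF th this smooth_on_ddt[OF ab 1]]
  show "smooth_on {a..b} (costate \<Psi> M C {a..b} q \<mu> j)"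
    using \<mu> by (cases "j \<in> M") (simp_all add: costate_def kappa_def[abs_def])
qed

lemma smooth_on_euler_lagrange:
  fixes \<Psi> :: "real^'n \<Rightarrow> real^'n^'n"
  assumes "open U" and ab: "a < b" and \<Psi>: "smooth_on U \<Psi>" "\<And>x. x \<in> U \<Longrightarrow> invertible (\<Psi> x)"
    and C: "smooth_on (U \<times> UNIV \<times> UNIV) (\<lambda>(x, u, a). C x u a)"
    and q: "smooth_on {a..b} q" "\<And>t. t \<in> {a..b} \<Longrightarrow> q t \<in> U"
    and \<mu>: "\<And>\<sigma>. \<sigma> \<in> M \<Longrightarrow> smooth_on {a..b} (\<mu> \<sigma>)"
  shows "smooth_on {a..b} (euler_lagrange \<Psi> M C {a..b} q \<mu> r)"
proof -
  note th = thick_interval[OF ab]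
  note u = smooth_on_quasi_vel[OF ab \<Psi>(1) q] and acc = smooth_on_quasi_acc[OF ab \<Psi>(1) q]
  have 1: "smooth_on {a..b} (\<lambda>t. pd (\<lambda>x. C x (quasi_vel \<Psi> {a..b} q t) (quasi_acc \<Psi> {a..b} q t)) j (q t))" for j
    by (rule smooth_on_compose3[OF smooth_on_pd_cost(1)[OF assms(1) C] th q(1) u acc]) (use q in auto)
  have 2: "smooth_on {a..b} (\<lambda>t. Phi \<Psi> (q t))"
    by (rule smooth_on_compose[OF smooth_on_Phi th q]) (use assms thick_open in auto)
  have 3: "smooth_on {a..b} (\<lambda>t. hamel \<Psi> (q t) j p r)" for j p r
    by (rule smooth_on_compose[OF smooth_on_hamel[OF assms(1) \<Psi>] th q])
  note 4 = smooth_on_costate(2)[OF assms(1) ab \<Psi>(1) C q \<mu>]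
  show ?thesis
    unfolding euler_lagrange_def dtheta_def
    by (intro smooth_on_add smooth_on_diff smooth_on_sum smooth_on_mult smooth_on_vec_nth
        smooth_on_ddt 1 2 3 4 u th ab)
qed

text \<open>The entire integrand is recognised as the derivative of one function \<open>B\<close>,
  so a single use of the fundamental theorem replaces two integrations by parts, and the summands
  need not be shown integrable one by one.\<close>

lemma variation_by_parts:
  fixes \<Psi> :: "real^'n \<Rightarrow> real^'n^'n" and C :: "real^'n \<Rightarrow> real^'n \<Rightarrow> real^'n \<Rightarrow> real"
    and \<xi> \<upsilon> \<xi>' \<upsilon>' :: "real \<Rightarrow> real^'n"
  assumes "open U" and ab: "a < b" and \<Psi>: "smooth_on U \<Psi>" "\<And>x. x \<in> U \<Longrightarrow> invertible (\<Psi> x)"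
    and C: "smooth_on (U \<times> UNIV \<times> UNIV) (\<lambda>(x, u, a). C x u a)"
    and unconstr: "\<And>x u a. C x (unconstr M u) (unconstr M a) = C x u a"
    and q: "smooth_on {a..b} q" "\<And>t. t \<in> {a..b} \<Longrightarrow> q t \<in> U"
    and \<mu>: "\<And>\<sigma>. \<sigma> \<in> M \<Longrightarrow> smooth_on {a..b} (\<mu> \<sigma>)"
    and d\<xi>: "\<And>t. t \<in> {a..b} \<Longrightarrow> (\<xi> has_vector_derivative \<xi>' t) (at t within {a..b})"
    and d\<upsilon>: "\<And>t. t \<in> {a..b} \<Longrightarrow> (\<upsilon> has_vector_derivative \<upsilon>' t) (at t within {a..b})"
    and \<upsilon>: "\<And>t. t \<in> {a..b} \<Longrightarrow>
      \<upsilon> t = frechet_derivative \<Psi> (at (q t)) (\<xi> t) *v ddt {a..b} q t + \<Psi> (q t) *v \<xi>' t"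
    and ends: "\<xi> a = 0" "\<xi> b = 0" "\<upsilon> a = 0" "\<upsilon> b = 0"
  defines "u \<equiv> quasi_vel \<Psi> {a..b} q" and "acc \<equiv> quasi_acc \<Psi> {a..b} q"
  shows "((\<lambda>t. frechet_derivative (\<lambda>(x, u, a). C x u a) (at (q t, u t, acc t) within U \<times> UNIV \<times> UNIV)
          (\<xi> t, \<upsilon> t, \<upsilon>' t) + (\<Sum>\<sigma>\<in>M. \<mu> \<sigma> t * \<upsilon> t $ \<sigma>)
        - (\<Sum>r\<in>UNIV. euler_lagrange \<Psi> M C {a..b} q \<mu> r t * (\<Psi> (q t) *v \<xi> t) $ r)) has_integral 0) {a..b}"
    (is "(?f has_integral 0) _")
proof -
  define A where "A J t = pd (C (q t) (u t)) J (acc t)" for J t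
  define l where "l = costate \<Psi> M C {a..b} q \<mu>"
  define \<eta> where "\<eta> t = \<Psi> (q t) *v \<xi> t" for t
  define \<eta>' where "\<eta>' t = \<Psi> (q t) *v \<xi>' t + frechet_derivative \<Psi> (at (q t)) (ddt {a..b} q t) *v \<xi> t" for t
  \<comment> \<open>The two boundary terms: \<open>A \<upsilon>\<close> from moving the time
    derivative off the quasi-accelerations, \<open>l \<eta>\<close> from moving it off the
    quasi-velocities. The first is why the velocity has to be fixed at the endpoints.\<close>
  define B where "B t = (\<Sum>J\<in>- M. A J t * \<upsilon> t $ J) + (\<Sum>j\<in>UNIV. l j t * \<eta> t $ j)" for t
  define B' where "B' t = (\<Sum>J\<in>- M. ddt {a..b} (A J) t * \<upsilon> t $ J + A J t * \<upsilon>' t $ J)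
      + (\<Sum>j\<in>UNIV. ddt {a..b} (l j) t * \<eta> t $ j + l j t * \<eta>' t $ j)" for t
  note sm = smooth_on_costate[where M = M and \<mu> = \<mu>, OF assms(1) ab \<Psi>(1) C q \<mu>]
  have smooth_A: "smooth_on {a..b} (A J)" for J
    unfolding A_def[abs_def] u_def acc_def by (rule sm(1))
  have smooth_l: "smooth_on {a..b} (l J)" for J
    unfolding l_def by (rule sm(2))
  have component: "((\<lambda>t. f t $ j) has_real_derivative f' $ j) (at t within {a..b})"
    if "(f has_vector_derivative f') (at t within {a..b})" for f :: "real \<Rightarrow> real^'n" and f' j t
    unfolding has_real_derivative_iff_has_vector_derivative
    by (rule bounded_linear.has_vector_derivative[OF bounded_linear_vec_nth that])
  have B: "(B has_vector_derivative B' t) (at t within {a..b})"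
    and f: "?f t = B' t" if t: "t \<in> {a..b}" for t
  proof -
    have D: "(\<Psi> has_derivative frechet_derivative \<Psi> (at (q t))) (at (q t))"
      using smooth_on_has_derivative[OF \<Psi>(1) q(2)[OF t]] at_within_open[OF q(2)[OF t] assms(1)] by simp
    have d\<eta>: "(\<eta> has_vector_derivative \<eta>' t) (at t within {a..b})"
      using bounded_bilinear.has_vector_derivative[OF bounded_bilinear_matrix_vector_mult
          vector_derivative_diff_chain_within[OF smooth_on_has_ddt[OF ab q(1) t]
            has_derivative_at_withinI[OF D]] d\<xi>[OF t]]
      unfolding \<eta>_def[abs_def] \<eta>'_def o_def .
    have dA: "(A J has_real_derivative ddt {a..b} (A J) t) (at t within {a..b})"
      and dl: "(l J has_real_derivative ddt {a..b} (l J) t) (at t within {a..b})" for J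
      unfolding has_real_derivative_iff_has_vector_derivative
      by (rule smooth_on_has_ddt[OF ab smooth_A t], rule smooth_on_has_ddt[OF ab smooth_l t])
    have "((\<lambda>t. A J t * \<upsilon> t $ J) has_real_derivative ddt {a..b} (A J) t * \<upsilon> t $ J + A J t * \<upsilon>' t $ J)
        (at t within {a..b})"
      and "((\<lambda>t. l J t * \<eta> t $ J) has_real_derivative ddt {a..b} (l J) t * \<eta> t $ J + l J t * \<eta>' t $ J)
        (at t within {a..b})" for J
      using DERIV_mult[OF dA component[OF d\<upsilon>[OF t]], of J J] DERIV_mult[OF dl component[OF d\<eta>], of J J]
      by (simp_all only: mult.commute)
    then have "(B has_real_derivative B' t) (at t within {a..b})"
      unfolding B_def[abs_def] B'_def by (intro DERIV_add DERIV_sum)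
    then show "(B has_vector_derivative B' t) (at t within {a..b})"
      by (simp add: has_real_derivative_iff_has_vector_derivative)
    note inv = \<Psi>(2)[OF q(2)[OF t]]
    have \<upsilon>j: "\<upsilon> t $ j = \<eta>' t $ j + (\<Sum>p\<in>UNIV. \<Sum>r\<in>UNIV. hamel \<Psi> (q t) j p r * u t $ p * \<eta> t $ r)" for j
      using transpositional_relation[OF inv D, of "\<xi> t" "ddt {a..b} q t" j]
      by (simp add: \<upsilon>[OF t] \<eta>'_def \<eta>_def u_def quasi_vel_def)
    have lj: "l j t = (if j \<in> M then \<mu> j t else pd (\<lambda>v. C (q t) v (acc t)) j (u t) - ddt {a..b} (A j) t)" for j
      by (simp add: l_def costate_def kappa_def A_def[abs_def] u_def acc_def)
    have "?f t = (\<Sum>r\<in>UNIV. dtheta \<Psi> (\<lambda>x. C x (u t) (acc t)) r (q t) * \<eta> t $ r)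
        + (\<Sum>J\<in>- M. pd (\<lambda>v. C (q t) v (acc t)) J (u t) * \<upsilon> t $ J)
        + (\<Sum>J\<in>- M. A J t * \<upsilon>' t $ J) + (\<Sum>\<sigma>\<in>M. \<mu> \<sigma> t * \<upsilon> t $ \<sigma>)
        - (\<Sum>r\<in>UNIV. (dtheta \<Psi> (\<lambda>x. C x (u t) (acc t)) r (q t) - ddt {a..b} (l r) t
            + (\<Sum>j\<in>UNIV. \<Sum>p\<in>UNIV. l j t * hamel \<Psi> (q t) j p r * u t $ p)) * \<eta> t $ r)"
      unfolding frechet_derivative_cost_expansion[OF assms(1) q(2)[OF t] C unconstr]
        euler_lagrange_def l_def A_def u_def acc_def \<eta>_def sum_dtheta[of \<Psi> "q t", OF inv] ..
    also have "\<dots> = B' t"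
      unfolding B'_def by (rule by_parts_algebra[OF \<upsilon>j lj])
    finally show "?f t = B' t" .
  qed
  have "(B' has_integral B b - B a) {a..b}"
    using ab B by (intro fundamental_theorem_of_calculus) auto
  moreover have "B b = 0" "B a = 0"
    by (simp_all add: B_def \<eta>_def ends)
  ultimately have "(B' has_integral 0) {a..b}" by simp
  then show ?thesis
    by (rule has_integral_eq[rotated]) (rule f[symmetric])
qed

section \<open>The derivative of the augmented cost along a variation\<close>

text \<open>Naming the value \<open>v\<close> records integrability and the derivative together. One
  direction of the equivalence computes \<open>v\<close> from a vanishing integrand, the other draws
  information about the integrand from \<open>v = 0\<close>.\<close>

lemma first_variation:
  fixes \<Psi> :: "real^'n \<Rightarrow> real^'n^'n" and C :: "real^'n \<Rightarrow> real^'n \<Rightarrow> real^'n \<Rightarrow> real"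
  assumes U: "open U" and ab: "a < b" and \<Psi>: "smooth_on U \<Psi>" "\<And>x. x \<in> U \<Longrightarrow> invertible (\<Psi> x)"
    and C: "smooth_on (U \<times> UNIV \<times> UNIV) (\<lambda>(x, u, a). C x u a)"
    and unconstr: "\<And>x u a. C x (unconstr M u) (unconstr M a) = C x u a"
    and q: "smooth_on {a..b} q" "\<And>t. t \<in> {a..b} \<Longrightarrow> q t \<in> U"
    and \<mu>: "\<And>\<sigma>. \<sigma> \<in> M \<Longrightarrow> smooth_on {a..b} (\<mu> \<sigma>)"
    and \<epsilon>: "0 < \<epsilon>" and cv: "curve_variation U a b \<epsilon> q qv" and mv: "multiplier_variation M a b \<epsilon> \<mu> \<mu>v"
  shows "\<exists>v. ((\<lambda>t. (\<Sum>r\<in>UNIV. euler_lagrange \<Psi> M C {a..b} q \<mu> r t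
              * (\<Psi> (q t) *v vector_derivative (\<lambda>s. qv s t) (at 0)) $ r)
            + (\<Sum>\<sigma>\<in>M. vector_derivative (\<lambda>s. \<mu>v s \<sigma> t) (at 0) * quasi_vel \<Psi> {a..b} q t $ \<sigma>))
          has_integral v) {a..b}
      \<and> ((\<lambda>s. augmented_cost \<Psi> M C a b (qv s) (\<mu>v s)) has_real_derivative v) (at 0)"
proof -
  \<comment> \<open>All quantities become functions of \<open>z = (s, t)\<close> on one rectangle.
    Time derivatives of the varied curves are then directional derivatives of smooth functions,
    hence jointly smooth in \<open>s\<close> and \<open>t\<close>.\<close>
  define R where "R = {-\<epsilon>..\<epsilon>} \<times> {a..b}"
  define Q where "Q z = qv (fst z) (snd z)" for z
  define Qt where "Qt z = frechet_derivative Q (at z within R) (0, 1)" for z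
  define V where "V z = \<Psi> (Q z) *v Qt z" for z
  define Vt where "Vt z = frechet_derivative V (at z within R) (0, 1)" for z
  define N where "N \<sigma> z = \<mu>v (fst z) \<sigma> (snd z)" for \<sigma> z
  define F where "F z = C (Q z) (V z) (Vt z) + (\<Sum>\<sigma>\<in>M. N \<sigma> z * V z $ \<sigma>)" for z
  let ?u = "quasi_vel \<Psi> {a..b} q" and ?acc = "quasi_acc \<Psi> {a..b} q"
  have \<epsilon>': "-\<epsilon> < \<epsilon>" and S0: "0 \<in> {-\<epsilon>..\<epsilon>}" using \<epsilon> by auto
  \<comment> \<open>Since 0 is interior to the parameter interval, the one-sided calculus on the
    rectangle yields the two-sided derivative demanded by \<open>stationary\<close>.\<close>
  have at0: "at 0 within {-\<epsilon>..\<epsilon>} = at (0::real)"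
    by (rule at_within_Icc_at) (use \<epsilon> in auto)
  have thR: "thick R"
    unfolding R_def by (intro thick_Times thick_interval ab \<epsilon>')
  have Q: "smooth_on R Q"
    using cv by (simp add: curve_variation_def R_def Q_def[abs_def] case_prod_unfold)
  have QU: "Q z \<in> U" if "z \<in> R" for z
    using cv that by (auto simp: curve_variation_def R_def Q_def)
  have qv0: "qv 0 t = q t" if "t \<in> {a..b}" for t
    using cv that by (auto simp: curve_variation_def)
  have Qt: "smooth_on R Qt"
    unfolding Qt_def by (rule smooth_on_frechet_derivative[OF Q])
  have V: "smooth_on R V"
    unfolding V_def by (intro smooth_on_matrix_vector_mult smooth_on_compose[OF \<Psi>(1)] thR Q Qt QU)
  have Vt: "smooth_on R Vt"
    unfolding Vt_def by (rule smooth_on_frechet_derivative[OF V])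
  have N: "smooth_on R (N \<sigma>)" if "\<sigma> \<in> M" for \<sigma>
    using mv that by (simp add: multiplier_variation_def R_def N_def[abs_def] case_prod_unfold)
  have F: "smooth_on R F"
    unfolding F_def
    by (intro smooth_on_add smooth_on_sum smooth_on_mult smooth_on_vec_nth smooth_on_compose3[OF C]
        thR Q V Vt N) (auto simp: QU)
  note ds = smooth_on_partial_fst[where S = "{-\<epsilon>..\<epsilon>}" and T = "{a..b}", folded R_def]
  note dt = smooth_on_partial_snd[where S = "{-\<epsilon>..\<epsilon>}" and T = "{a..b}", folded R_def]
  have ddt_qv: "ddt {a..b} (qv s) t = Qt (s, t)" if "s \<in> {-\<epsilon>..\<epsilon>}" "t \<in> {a..b}" for s t
    unfolding Qt_def by (rule ddt_eqI[OF ab that(2) dt[OF Q that]]) (simp add: Q_def)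
  have vel: "quasi_vel \<Psi> {a..b} (qv s) t = V (s, t)" if "s \<in> {-\<epsilon>..\<epsilon>}" "t \<in> {a..b}" for s t
    using ddt_qv[OF that] by (simp add: quasi_vel_def V_def Q_def)
  have acc: "quasi_acc \<Psi> {a..b} (qv s) t = Vt (s, t)" if "s \<in> {-\<epsilon>..\<epsilon>}" "t \<in> {a..b}" for s t
    unfolding quasi_acc_def Vt_def by (rule ddt_eqI[OF ab that(2) dt[OF V that] vel[OF that(1)]])
  have at_zero: "Q (0, t) = q t" "Qt (0, t) = ddt {a..b} q t" "V (0, t) = ?u t" "Vt (0, t) = ?acc t"
    if t: "t \<in> {a..b}" for t
    using ddt_cong[OF t qv0] quasi_vel_cong[where \<Psi> = \<Psi>, OF t qv0] quasi_acc_cong[where \<Psi> = \<Psi>, OF t qv0]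
      ddt_qv[OF S0 t] vel[OF S0 t] acc[OF S0 t] qv0[OF t] by (simp_all add: Q_def)
  have N0: "N \<sigma> (0, t) = \<mu> \<sigma> t" if "\<sigma> \<in> M" "t \<in> {a..b}" for \<sigma> t
    using mv that by (auto simp: multiplier_variation_def N_def)
  define \<xi> where "\<xi> t = frechet_derivative Q (at (0, t) within R) (1, 0)" for t
  define \<xi>' where "\<xi>' t = frechet_derivative Qt (at (0, t) within R) (1, 0)" for t
  define \<upsilon> where "\<upsilon> t = frechet_derivative V (at (0, t) within R) (1, 0)" for t
  define \<upsilon>' where "\<upsilon>' t = frechet_derivative Vt (at (0, t) within R) (1, 0)" for t
  define \<nu> where "\<nu> \<sigma> t = frechet_derivative (N \<sigma>) (at (0, t) within R) (1, 0)" for \<sigma> t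
  have \<xi>: "vector_derivative (\<lambda>s. qv s t) (at 0) = \<xi> t" if "t \<in> {a..b}" for t
    using ds[OF Q S0 that] unfolding at0 \<xi>_def Q_def[abs_def] fst_conv snd_conv
    by (rule vector_derivative_at)
  have \<nu>: "vector_derivative (\<lambda>s. \<mu>v s \<sigma> t) (at 0) = \<nu> \<sigma> t" if "\<sigma> \<in> M" "t \<in> {a..b}" for \<sigma> t
    using ds[OF N[OF that(1)] S0 that(2)] unfolding at0 \<nu>_def N_def[abs_def] fst_conv snd_conv
    by (rule vector_derivative_at)
  \<comment> \<open>Equality of mixed derivatives: \<xi>' was defined as the
    \<open>s\<close>-derivative of the velocity, and turns out to be the time derivative of \<xi>.
    The same holds for \<upsilon> and \<upsilon>' below.\<close>
  have d\<xi>: "(\<xi> has_vector_derivative \<xi>' t) (at t within {a..b})" if "t \<in> {a..b}" for t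
    using smooth_on_mixed_derivative[OF \<epsilon>' ab Q[unfolded R_def] S0 that]
    unfolding \<xi>_def[abs_def] \<xi>'_def Qt_def[abs_def] R_def .
  have d\<upsilon>: "(\<upsilon> has_vector_derivative \<upsilon>' t) (at t within {a..b})" if "t \<in> {a..b}" for t
    using smooth_on_mixed_derivative[OF \<epsilon>' ab V[unfolded R_def] S0 that]
    unfolding \<upsilon>_def[abs_def] \<upsilon>'_def Vt_def[abs_def] R_def .
  have mem: "(0, t) \<in> R" if "t \<in> {a..b}" for t
    using that \<epsilon> by (simp add: R_def)
  \<comment> \<open>The product rule for \<open>V\<close>, with \<Psi> differentiated along the
    curve variation \<xi> and the velocity varying by \<xi>'.\<close>
  have \<upsilon>: "\<upsilon> t = frechet_derivative \<Psi> (at (q t)) (\<xi> t) *v ddt {a..b} q t + \<Psi> (q t) *v \<xi>' t"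
    if t: "t \<in> {a..b}" for t
  proof -
    have "(\<Psi> has_derivative frechet_derivative \<Psi> (at (q t))) (at (q t))"
      using smooth_on_has_derivative[OF \<Psi>(1) q(2)[OF t]] at_within_open[OF q(2)[OF t] U] by simp
    then have "(\<Psi> has_derivative frechet_derivative \<Psi> (at (q t))) (at (Q (0, t)))"
      by (simp add: at_zero[OF t])
    from thick_frechet_derivative[OF thR mem[OF t] bounded_bilinear.FDERIV[OF
          bounded_bilinear_matrix_vector_mult
          has_derivative_compose[OF smooth_on_has_derivative[OF Q mem[OF t]] this]
          smooth_on_has_derivative[OF Qt mem[OF t]]]]
    show ?thesis
      by (simp add: \<upsilon>_def \<xi>_def \<xi>'_def V_def[abs_def] at_zero[OF t] add.commute)
  qed
  have const: "frechet_derivative G (at (0, t) within R) (1, 0) = 0"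
    if "smooth_on R G" "t \<in> {a..b}" "\<And>s. s \<in> {-\<epsilon>..\<epsilon>} \<Longrightarrow> G (s, t) = c"
    for G :: "real \<times> real \<Rightarrow> real^'n" and t c
    using vector_derivative_unique_within[OF at_within_Icc_nontrivial[OF \<epsilon>' S0] ds[OF that(1) S0 that(2)]
        has_vector_derivative_transform[OF S0 that(3) has_vector_derivative_const]] .
  \<comment> \<open>At an endpoint neither \<open>q\<close> nor its velocity depends on
    \<open>s\<close>, so \<open>V\<close>, which is built from these two alone, is constant in
    \<open>s\<close> there.\<close>
  have ends: "\<xi> t = 0" "\<upsilon> t = 0" if t: "t \<in> {a, b}" for t
  proof -
    have t': "t \<in> {a..b}" using t ab by auto
    have fixed: "qv s t = q t \<and> ddt {a..b} (qv s) t = ddt {a..b} q t" if "s \<in> {-\<epsilon>..\<epsilon>}" for s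
      using cv that t unfolding curve_variation_def by blast
    show "\<xi> t = 0"
      unfolding \<xi>_def using fixed by (intro const[OF Q t', of "q t"]) (simp add: Q_def)
    show "\<upsilon> t = 0"
      unfolding \<upsilon>_def using fixed vel[OF _ t']
      by (intro const[OF V t', of "?u t"]) (simp add: quasi_vel_def flip: vel)
  qed
  have Fs: "frechet_derivative F (at (0, t) within R) (1, 0) =
      frechet_derivative (\<lambda>(x, u, a). C x u a) (at (q t, ?u t, ?acc t) within U \<times> UNIV \<times> UNIV)
        (\<xi> t, \<upsilon> t, \<upsilon>' t) + (\<Sum>\<sigma>\<in>M. \<mu> \<sigma> t * \<upsilon> t $ \<sigma>) + (\<Sum>\<sigma>\<in>M. \<nu> \<sigma> t * ?u t $ \<sigma>)"
    if t: "t \<in> {a..b}" for t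
  proof -
    let ?z = "(0, t)" and ?Z = "U \<times> (UNIV :: (real^'n) set) \<times> (UNIV :: (real^'n) set)"
    let ?C = "\<lambda>(x, u, a). C x u a"
    have "(q t, ?u t, ?acc t) \<in> ?Z" using q(2)[OF t] by simp
    from smooth_on_has_derivative[OF C this]
    have "(?C has_derivative frechet_derivative ?C (at (q t, ?u t, ?acc t) within ?Z))
        (at (Q ?z, V ?z, Vt ?z) within (\<lambda>z. (Q z, V z, Vt z)) ` R)"
      unfolding at_zero[OF t] by (rule has_derivative_subset) (use QU in auto)
    from has_derivative_in_compose[OF has_derivative_Pair[OF smooth_on_has_derivative[OF Q mem[OF t]]
          has_derivative_Pair[OF smooth_on_has_derivative[OF V mem[OF t]]
            smooth_on_has_derivative[OF Vt mem[OF t]]]] this]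
    have 1: "((\<lambda>z. C (Q z) (V z) (Vt z)) has_derivative
        (\<lambda>h. frechet_derivative ?C (at (q t, ?u t, ?acc t) within ?Z)
          (frechet_derivative Q (at ?z within R) h, frechet_derivative V (at ?z within R) h,
           frechet_derivative Vt (at ?z within R) h))) (at ?z within R)"
      by simp
    have 2: "((\<lambda>z. N \<sigma> z * V z $ \<sigma>) has_derivative
        (\<lambda>h. N \<sigma> ?z * frechet_derivative V (at ?z within R) h $ \<sigma>
          + frechet_derivative (N \<sigma>) (at ?z within R) h * V ?z $ \<sigma>)) (at ?z within R)"
      if "\<sigma> \<in> M" for \<sigma>
      by (rule has_derivative_mult[OF smooth_on_has_derivative[OF N[OF that] mem[OF t]]
            bounded_linear.has_derivative[OF bounded_linear_vec_nth smooth_on_has_derivative[OF V mem[OF t]]]])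
    from thick_frechet_derivative[OF thR mem[OF t] has_derivative_add[OF 1 has_derivative_sum[OF 2]]]
    have "frechet_derivative F (at ?z within R) (1, 0) =
        frechet_derivative ?C (at (q t, ?u t, ?acc t) within ?Z) (\<xi> t, \<upsilon> t, \<upsilon>' t)
        + (\<Sum>\<sigma>\<in>M. N \<sigma> ?z * \<upsilon> t $ \<sigma> + \<nu> \<sigma> t * V ?z $ \<sigma>)"
      unfolding F_def[abs_def] \<xi>_def \<upsilon>_def \<upsilon>'_def \<nu>_def by (rule fun_cong)
    then show ?thesis
      using N0[OF _ t] at_zero(3)[OF t] by (simp add: sum.distrib)
  qed
  define v where "v = integral {a..b} (\<lambda>t. frechet_derivative F (at (0, t) within R) (1, 0))"
  note contF = smooth_on_imp_continuous_on[OF F]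
    smooth_on_imp_continuous_on[OF smooth_on_frechet_derivative[OF F]]
  have Fs_int: "((\<lambda>t. frechet_derivative F (at (0, t) within R) (1, 0)) has_integral v) {a..b}"
    unfolding v_def
    by (intro integrable_integral integrable_continuous_interval
        continuous_on_compose2[OF contF(2)[of "(1, 0)"], where f = "\<lambda>t. (0, t)"])
      (auto intro!: continuous_intros mem)
  have "((\<lambda>s. integral (cbox a b) (\<lambda>t. F (s, t))) has_real_derivative
      integral (cbox a b) (\<lambda>t. frechet_derivative F (at (0, t) within R) (1, 0))) (at 0 within {-\<epsilon>..\<epsilon>})"
  proof (rule leibniz_rule_field_derivative[where
        fx = "\<lambda>s t. frechet_derivative F (at (s, t) within R) (1, 0)", OF _ _ _ S0])
    show "((\<lambda>s. F (s, t)) has_real_derivative frechet_derivative F (at (s, t) within R) (1, 0))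
        (at s within {-\<epsilon>..\<epsilon>})" if "s \<in> {-\<epsilon>..\<epsilon>}" "t \<in> cbox a b" for s t
      using ds[OF F that(1)] that(2) by (simp add: has_real_derivative_iff_has_vector_derivative)
    show "(\<lambda>t. F (s, t)) integrable_on cbox a b" if "s \<in> {-\<epsilon>..\<epsilon>}" for s
      by (intro integrable_continuous continuous_on_compose2[OF contF(1), where f = "\<lambda>t. (s, t)"])
        (use that in \<open>auto simp: R_def intro!: continuous_intros\<close>)
    show "continuous_on ({-\<epsilon>..\<epsilon>} \<times> cbox a b) (\<lambda>(s, t). frechet_derivative F (at (s, t) within R) (1, 0))"
      using contF(2)[of "(1, 0)"] by (simp add: R_def case_prod_unfold)
  qed simp
  then have "((\<lambda>s. integral {a..b} (\<lambda>t. F (s, t))) has_real_derivative v) (at 0 within {-\<epsilon>..\<epsilon>})"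
    by (simp add: v_def)
  then have "((\<lambda>s. augmented_cost \<Psi> M C a b (qv s) (\<mu>v s)) has_real_derivative v) (at 0 within {-\<epsilon>..\<epsilon>})"
  proof (rule has_field_derivative_transform_within[OF _ \<epsilon> S0])
    fix s assume s: "s \<in> {-\<epsilon>..\<epsilon>}" and "dist s 0 < \<epsilon>"
    show "integral {a..b} (\<lambda>t. F (s, t)) = augmented_cost \<Psi> M C a b (qv s) (\<mu>v s)"
      unfolding augmented_cost_def using s vel acc
      by (intro integral_cong) (simp add: F_def Q_def N_def)
  qed
  \<comment> \<open>Subtracting the integrand that \<open>variation_by_parts\<close> shows to have
    integral 0 changes the integrand into the desired form while leaving \<open>v\<close>
    unchanged.\<close>
  moreover have "((\<lambda>t. (\<Sum>r\<in>UNIV. euler_lagrange \<Psi> M C {a..b} q \<mu> r t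
              * (\<Psi> (q t) *v vector_derivative (\<lambda>s. qv s t) (at 0)) $ r)
            + (\<Sum>\<sigma>\<in>M. vector_derivative (\<lambda>s. \<mu>v s \<sigma> t) (at 0) * ?u t $ \<sigma>)) has_integral v) {a..b}"
  proof (rule has_integral_eq[rotated])
    show "((\<lambda>t. frechet_derivative F (at (0, t) within R) (1, 0)
        - (frechet_derivative (\<lambda>(x, u, a). C x u a) (at (q t, ?u t, ?acc t) within U \<times> UNIV \<times> UNIV)
            (\<xi> t, \<upsilon> t, \<upsilon>' t) + (\<Sum>\<sigma>\<in>M. \<mu> \<sigma> t * \<upsilon> t $ \<sigma>)
          - (\<Sum>r\<in>UNIV. euler_lagrange \<Psi> M C {a..b} q \<mu> r t * (\<Psi> (q t) *v \<xi> t) $ r))) has_integral v) {a..b}"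
      using has_integral_diff[OF Fs_int variation_by_parts[where M = M and \<mu> = \<mu> and C = C and \<Psi> = \<Psi>,
            OF U ab \<Psi> C unconstr q \<mu> d\<xi> d\<upsilon> \<upsilon> ends(1) ends(1) ends(2) ends(2)]] by simp
  next
    fix t assume t: "t \<in> {a..b}"
    have "(\<Sum>\<sigma>\<in>M. vector_derivative (\<lambda>s. \<mu>v s \<sigma> t) (at 0) * ?u t $ \<sigma>) = (\<Sum>\<sigma>\<in>M. \<nu> \<sigma> t * ?u t $ \<sigma>)"
      by (intro sum.cong refl) (simp add: \<nu>[OF _ t])
    then show "frechet_derivative F (at (0, t) within R) (1, 0)
        - (frechet_derivative (\<lambda>(x, u, a). C x u a) (at (q t, ?u t, ?acc t) within U \<times> UNIV \<times> UNIV)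
            (\<xi> t, \<upsilon> t, \<upsilon>' t) + (\<Sum>\<sigma>\<in>M. \<mu> \<sigma> t * \<upsilon> t $ \<sigma>)
          - (\<Sum>r\<in>UNIV. euler_lagrange \<Psi> M C {a..b} q \<mu> r t * (\<Psi> (q t) *v \<xi> t) $ r))
      = (\<Sum>r\<in>UNIV. euler_lagrange \<Psi> M C {a..b} q \<mu> r t
              * (\<Psi> (q t) *v vector_derivative (\<lambda>s. qv s t) (at 0)) $ r)
            + (\<Sum>\<sigma>\<in>M. vector_derivative (\<lambda>s. \<mu>v s \<sigma> t) (at 0) * ?u t $ \<sigma>)"
      unfolding Fs[OF t] \<xi>[OF t] by (simp only:)
  qed
  ultimately show ?thesis unfolding at0 by blast
qed

section \<open>The Boltzmann-Hamel equations\<close>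

text \<open>The constraints remove the terms with \<open>p\<close> in \<open>M\<close>; splitting
  \<open>j\<close> along \<open>M\<close> then separates the \<mu>-part of the costate from its
  \<kappa>-part.\<close>

lemma euler_lagrange_constrained:
  fixes q :: "real \<Rightarrow> real^'n"
  assumes "\<And>\<sigma>. \<sigma> \<in> M \<Longrightarrow> quasi_vel \<Psi> T q t $ \<sigma> = 0"
  shows "euler_lagrange \<Psi> M C T q \<mu> r t =
    dtheta \<Psi> (\<lambda>x. C x (quasi_vel \<Psi> T q t) (quasi_acc \<Psi> T q t)) r (q t)
    - ddt T (if r \<in> M then \<mu> r else kappa \<Psi> C T q r) t
    + (\<Sum>J\<in>- M. \<Sum>S\<in>- M. kappa \<Psi> C T q J t * hamel \<Psi> (q t) J S r * quasi_vel \<Psi> T q t $ S)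
    + (\<Sum>\<tau>\<in>M. \<Sum>S\<in>- M. \<mu> \<tau> t * hamel \<Psi> (q t) \<tau> S r * quasi_vel \<Psi> T q t $ S)"
proof -
  let ?l = "costate \<Psi> M C T q \<mu>" and ?u = "quasi_vel \<Psi> T q t"
  have "(\<Sum>p\<in>UNIV. ?l j t * hamel \<Psi> (q t) j p r * ?u $ p) = (\<Sum>S\<in>- M. ?l j t * hamel \<Psi> (q t) j S r * ?u $ S)" for j
    by (rule sum.mono_neutral_right) (auto simp: assms)
  then have "(\<Sum>j\<in>UNIV. \<Sum>p\<in>UNIV. ?l j t * hamel \<Psi> (q t) j p r * ?u $ p) =
      (\<Sum>j\<in>M \<union> - M. \<Sum>S\<in>- M. ?l j t * hamel \<Psi> (q t) j S r * ?u $ S)"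
    by simp
  also have "\<dots> = (\<Sum>\<tau>\<in>M. \<Sum>S\<in>- M. ?l \<tau> t * hamel \<Psi> (q t) \<tau> S r * ?u $ S)
      + (\<Sum>J\<in>- M. \<Sum>S\<in>- M. ?l J t * hamel \<Psi> (q t) J S r * ?u $ S)"
    by (rule sum.union_disjoint) auto
  also have "\<dots> = (\<Sum>\<tau>\<in>M. \<Sum>S\<in>- M. \<mu> \<tau> t * hamel \<Psi> (q t) \<tau> S r * ?u $ S)
      + (\<Sum>J\<in>- M. \<Sum>S\<in>- M. kappa \<Psi> C T q J t * hamel \<Psi> (q t) J S r * ?u $ S)"
    by (intro arg_cong2[of _ _ _ _ "(+)"] sum.cong) (auto simp: costate_def)
  finally show ?thesis
    by (simp add: euler_lagrange_def costate_def)
qed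

text \<open>The velocity always equals \<open>Phi\<close> applied to the full \<open>u\<close>.
  Dropping the constrained components changes nothing exactly when they vanish, because
  \<open>Phi\<close> is injective.\<close>

lemma constraints_iff:
  fixes \<Psi> :: "real^'n \<Rightarrow> real^'n^'n"
  assumes "invertible (\<Psi> (q t))"
  shows "(\<forall>\<sigma>\<in>M. quasi_vel \<Psi> T q t $ \<sigma> = 0) \<longleftrightarrow>
    (\<forall>i. ddt T q t $ i = (\<Sum>S\<in>- M. Phi \<Psi> (q t) $ i $ S * quasi_vel \<Psi> T q t $ S))"
proof -
  let ?u = "quasi_vel \<Psi> T q t" and ?\<Phi> = "Phi \<Psi> (q t)"
  have "(?\<Phi> *v unconstr M ?u) $ i = (\<Sum>S\<in>- M. ?\<Phi> $ i $ S * ?u $ S)" for i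
  proof -
    have "(?\<Phi> *v unconstr M ?u) $ i = (\<Sum>S\<in>- M. ?\<Phi> $ i $ S * unconstr M ?u $ S)"
      unfolding matrix_vector_mult_def by (simp, rule sum.mono_neutral_right) (auto simp: unconstr_def)
    also have "\<dots> = (\<Sum>S\<in>- M. ?\<Phi> $ i $ S * ?u $ S)"
      by (rule sum.cong) (auto simp: unconstr_def)
    finally show ?thesis .
  qed
  then have "(\<forall>i. ddt T q t $ i = (\<Sum>S\<in>- M. ?\<Phi> $ i $ S * ?u $ S)) \<longleftrightarrow> ddt T q t = ?\<Phi> *v unconstr M ?u"
    by (simp add: vec_eq_iff)
  also have "\<dots> \<longleftrightarrow> ?u = unconstr M ?u"
    using Phi_Psi_mult[of \<Psi> "q t", OF assms] by (metis quasi_vel_def)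
  also have "\<dots> \<longleftrightarrow> (\<forall>\<sigma>\<in>M. ?u $ \<sigma> = 0)"
    by (auto simp: unconstr_def vec_eq_iff)
  finally show ?thesis by blast
qed

section \<open>Stationarity and the vanishing of the Euler-Lagrange expressions\<close>

lemma stationary_iff:
  fixes \<Psi> :: "real^'n \<Rightarrow> real^'n^'n" and C :: "real^'n \<Rightarrow> real^'n \<Rightarrow> real^'n \<Rightarrow> real"
  assumes U: "open U" and ab: "a < b" and \<Psi>: "smooth_on U \<Psi>" "\<And>x. x \<in> U \<Longrightarrow> invertible (\<Psi> x)"
    and C: "smooth_on (U \<times> UNIV \<times> UNIV) (\<lambda>(x, u, a). C x u a)"
    and unconstr: "\<And>x u a. C x (unconstr M u) (unconstr M a) = C x u a"
    and q: "smooth_on {a..b} q" "\<And>t. t \<in> {a..b} \<Longrightarrow> q t \<in> U"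
    and \<mu>: "\<And>\<sigma>. \<sigma> \<in> M \<Longrightarrow> smooth_on {a..b} (\<mu> \<sigma>)"
  shows "stationary \<Psi> M C U a b q \<mu> \<longleftrightarrow>
    (\<forall>t\<in>{a..b}. (\<forall>r. euler_lagrange \<Psi> M C {a..b} q \<mu> r t = 0) \<and> (\<forall>\<sigma>\<in>M. quasi_vel \<Psi> {a..b} q t $ \<sigma> = 0))"
    (is "_ \<longleftrightarrow> ?R")
proof
  let ?E = "euler_lagrange \<Psi> M C {a..b} q \<mu>" and ?u = "quasi_vel \<Psi> {a..b} q"
  note variation = first_variation[where M = M and C = C and \<Psi> = \<Psi>, OF U ab \<Psi> C unconstr q \<mu>]
  show "stationary \<Psi> M C U a b q \<mu>" if ?R
    unfolding stationary_def
  proof (intro allI impI, elim conjE)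
    fix \<epsilon> :: real and qv \<mu>v
    assume "0 < \<epsilon>" "curve_variation U a b \<epsilon> q qv" "multiplier_variation M a b \<epsilon> \<mu> \<mu>v"
    from variation[OF _ _ _ this] obtain v where
      v: "((\<lambda>t. (\<Sum>r\<in>UNIV. ?E r t * (\<Psi> (q t) *v vector_derivative (\<lambda>s. qv s t) (at 0)) $ r)
            + (\<Sum>\<sigma>\<in>M. vector_derivative (\<lambda>s. \<mu>v s \<sigma> t) (at 0) * ?u t $ \<sigma>)) has_integral v) {a..b}"
      and der: "((\<lambda>s. augmented_cost \<Psi> M C a b (qv s) (\<mu>v s)) has_real_derivative v) (at 0)"
      by blast
    have "((\<lambda>t::real. 0::real) has_integral v) {a..b}"
      by (rule has_integral_eq[OF _ v]) (use that in simp)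
    then have "v = 0" using has_integral_unique has_integral_0 by blast
    with der show "((\<lambda>s. augmented_cost \<Psi> M C a b (qv s) (\<mu>v s)) has_real_derivative 0) (at 0)"
      by simp
  qed
  show ?R if stat: "stationary \<Psi> M C U a b q \<mu>"
  proof -
    \<comment> \<open>Testing with the weighted gradient \<open>\<zeta>\<close> itself (which is smooth) replaces bump functions;
      the weight vanishes to second order at the endpoints.\<close>
    define P where "P t = (\<chi> i. \<Sum>r\<in>UNIV. ?E r t * \<Psi> (q t) $ r $ i)" for t
    define w where "w t = ((t - a) * (b - t))\<^sup>2" for t
    define \<zeta> where "\<zeta> t = w t *\<^sub>R P t" for t
    \<comment> \<open>\<open>P\<close> is the transpose of \<Psi> applied to \<open>E\<close>: in
      coordinates the first variation pairs the curve variation with \<open>P\<close> in the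
      Euclidean inner product, so a nonnegative multiple of \<open>P\<close> makes it a weighted
      square.\<close>
    have EP: "(\<Sum>r\<in>UNIV. ?E r t * (\<Psi> (q t) *v y) $ r) = P t \<bullet> y" for t y
    proof -
      have "(\<Sum>r\<in>UNIV. ?E r t * (\<Psi> (q t) *v y) $ r) = (\<Sum>r\<in>UNIV. \<Sum>i\<in>UNIV. ?E r t * \<Psi> (q t) $ r $ i * y $ i)"
        by (simp add: matrix_vector_mult_def sum_distrib_left mult.assoc)
      also have "\<dots> = P t \<bullet> y"
        by (subst sum.swap) (simp add: inner_vec_def P_def sum_distrib_right)
      finally show ?thesis .
    qed
    note th = thick_interval[OF ab]
    have u: "smooth_on {a..b} ?u" by (rule smooth_on_quasi_vel[OF ab \<Psi>(1) q])
    have E: "smooth_on {a..b} (?E r)" for r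
      by (rule smooth_on_euler_lagrange[OF U ab \<Psi> C q \<mu>])
    have P: "smooth_on {a..b} P"
      unfolding P_def
      by (intro smooth_on_vec_lambda smooth_on_sum smooth_on_mult smooth_on_vec_nth th E
          smooth_on_compose[OF \<Psi>(1) th q])
    have \<zeta>: "smooth_on {a..b} \<zeta>"
      unfolding \<zeta>_def w_def
      by (intro smooth_on_scaleR smooth_on_power smooth_on_mult smooth_on_diff smooth_on_ident
          smooth_on_const th P)
    have d\<zeta>: "ddt {a..b} \<zeta> t = 0" if "t \<in> {a, b}" for t
    proof -
      have t: "t \<in> {a..b}" using that ab by auto
      have "(w has_real_derivative 2 * ((t - a) * (b - t)) * ((b - t) - (t - a))) (at t within {a..b})"
        unfolding w_def[abs_def] by (auto intro!: derivative_eq_intros simp: algebra_simps)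
      then have "(w has_real_derivative 0) (at t within {a..b})" using that by auto
      from has_vector_derivative_scaleR[OF this smooth_on_has_ddt[OF ab P t]]
      have "(\<zeta> has_vector_derivative 0) (at t within {a..b})"
        using that unfolding \<zeta>_def[abs_def] by (auto simp: w_def)
      from ddt_eqI[OF ab t this] show ?thesis by simp
    qed
    \<comment> \<open>The varied curves must stay in the coordinate domain. By compactness a tube of
      some radius \<open>e\<close> about the curve lies in \<open>U\<close>, and \<zeta> is
      bounded.\<close>
    have "compact (q ` {a..b})" "q ` {a..b} \<subseteq> U"
      using smooth_on_imp_continuous_on[OF q(1)] q(2) by (auto intro: compact_continuous_image)
    with U obtain e where e: "e > 0" "(\<Union>x\<in>q ` {a..b}. ball x e) \<subseteq> U"
      using compact_subset_open_imp_ball_epsilon_subset by metis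
    have "bounded (\<zeta> ` {a..b})"
      using smooth_on_imp_continuous_on[OF \<zeta>] by (auto intro: compact_imp_bounded compact_continuous_image)
    then obtain B where B: "B > 0" "\<And>t. t \<in> {a..b} \<Longrightarrow> norm (\<zeta> t) \<le> B"
      unfolding bounded_pos by auto
    \<comment> \<open>With this \<epsilon> the displacement \<open>s *\<^sub>R \<zeta> t\<close> has
      norm at most \<open>e / 2\<close>, well inside the tube.\<close>
    define \<epsilon> where "\<epsilon> = e / (2 * B)"
    have \<epsilon>: "0 < \<epsilon>" using e(1) B(1) by (simp add: \<epsilon>_def)
    define qv where "qv s t = q t + s *\<^sub>R \<zeta> t" for s t
    define \<mu>v where "\<mu>v s \<sigma> t = \<mu> \<sigma> t + s * ?u t $ \<sigma>" for s \<sigma> t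
    let ?S = "{-\<epsilon>..\<epsilon>} \<times> {a..b}"
    have thR: "thick ?S"
      using \<epsilon> by (intro thick_Times thick_interval ab) auto
    have fst: "smooth_on ?S fst" and snd: "smooth_on ?S snd"
      using thR by (auto intro!: smooth_intros)
    have lift: "smooth_on ?S (\<lambda>z. f (snd z))" if "smooth_on {a..b} f" for f :: "real \<Rightarrow> real^'n"
      by (rule smooth_on_compose[OF that thR snd]) auto
    have lift': "smooth_on ?S (\<lambda>z. f (snd z))" if "smooth_on {a..b} f" for f :: "real \<Rightarrow> real"
      by (rule smooth_on_compose[OF that thR snd]) auto
    have "curve_variation U a b \<epsilon> q qv"
      unfolding curve_variation_def
    proof (intro conjI ballI)
      show "smooth_on ?S (\<lambda>(s, t). qv s t)"
        unfolding qv_def case_prod_unfold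
        by (intro smooth_on_add smooth_on_scaleR thR fst lift q(1) \<zeta>)
      show "qv s t \<in> U" if "s \<in> {-\<epsilon>..\<epsilon>}" "t \<in> {a..b}" for s t
      proof -
        have "norm (s *\<^sub>R \<zeta> t) \<le> \<epsilon> * B"
          using that B \<epsilon> by (auto intro!: mult_mono)
        also have "\<dots> < e" using e(1) B(1) by (simp add: \<epsilon>_def)
        finally have "qv s t \<in> ball (q t) e" by (simp add: qv_def dist_norm)
        then show ?thesis using e(2) that(2) by blast
      qed
      show "qv 0 t = q t" for t by (simp add: qv_def)
      fix s t assume t: "t \<in> {a, b}"
      then show "qv s t = q t" by (auto simp: qv_def \<zeta>_def w_def)
      have t': "t \<in> {a..b}" using t ab by auto
      have "((\<lambda>t. q t + s *\<^sub>R \<zeta> t) has_vector_derivative ddt {a..b} q t + s *\<^sub>R ddt {a..b} \<zeta> t) (at t within {a..b})"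
        by (intro has_vector_derivative_add smooth_on_has_ddt[OF ab _ t'] q(1)
            bounded_linear.has_vector_derivative[OF bounded_linear_scaleR_right] \<zeta>)
      from ddt_eqI[OF ab t' this] show "ddt {a..b} (qv s) t = ddt {a..b} q t"
        by (simp add: qv_def d\<zeta>[OF t])
    qed
    moreover have "multiplier_variation M a b \<epsilon> \<mu> \<mu>v"
      unfolding multiplier_variation_def
    proof (intro ballI conjI)
      fix \<sigma> assume "\<sigma> \<in> M"
      then show "smooth_on ?S (\<lambda>(s, t). \<mu>v s \<sigma> t)"
        unfolding \<mu>v_def case_prod_unfold
        by (intro smooth_on_add smooth_on_mult smooth_on_vec_nth thR fst lift lift' u \<mu>)
      show "\<mu>v 0 \<sigma> t = \<mu> \<sigma> t" for t by (simp add: \<mu>v_def)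
    qed
    ultimately have var: "0 < \<epsilon>" "curve_variation U a b \<epsilon> q qv" "multiplier_variation M a b \<epsilon> \<mu> \<mu>v"
      using \<epsilon> by auto
    have "((\<lambda>s. qv s t) has_vector_derivative \<zeta> t) (at 0)" for t
      unfolding qv_def by (auto intro!: derivative_eq_intros)
    then have dqv: "vector_derivative (\<lambda>s. qv s t) (at 0) = \<zeta> t" for t
      by (rule vector_derivative_at)
    have "((\<lambda>s. \<mu>v s \<sigma> t) has_vector_derivative ?u t $ \<sigma>) (at 0)" for \<sigma> t
      unfolding \<mu>v_def by (auto intro!: derivative_eq_intros)
    then have d\<mu>v: "vector_derivative (\<lambda>s. \<mu>v s \<sigma> t) (at 0) = ?u t $ \<sigma>" for \<sigma> t
      by (rule vector_derivative_at)
    \<comment> \<open>The first-variation integrand for this test pair. Both summands are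
      nonnegative, so the curve equations and the constraints come out of one variation.\<close>
    define f where "f t = w t * (P t \<bullet> P t) + (\<Sum>\<sigma>\<in>M. ?u t $ \<sigma> * ?u t $ \<sigma>)" for t
    from variation[OF _ _ _ var] obtain v where "(f has_integral v) {a..b}"
      and "((\<lambda>s. augmented_cost \<Psi> M C a b (qv s) (\<mu>v s)) has_real_derivative v) (at 0)"
      unfolding dqv d\<mu>v EP f_def[abs_def] by (auto simp: \<zeta>_def)
    moreover have "((\<lambda>s. augmented_cost \<Psi> M C a b (qv s) (\<mu>v s)) has_real_derivative 0) (at 0)"
      using stat var unfolding stationary_def by blast
    ultimately have int: "(f has_integral 0) {a..b}"
      using DERIV_unique by blast
    have contP: "continuous_on {a..b} P" and contu: "continuous_on {a..b} ?u"
      using smooth_on_imp_continuous_on P u by auto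
    have "continuous_on {a..b} f"
      unfolding f_def w_def by (intro continuous_intros contP contu)
    moreover have nonneg: "0 \<le> w t * (P t \<bullet> P t)" "0 \<le> (\<Sum>\<sigma>\<in>M. ?u t $ \<sigma> * ?u t $ \<sigma>)" for t
      by (auto simp: w_def intro!: sum_nonneg)
    \<comment> \<open>A continuous nonnegative function with integral 0 vanishes everywhere on the
      interval.\<close>
    ultimately have f0: "f t = 0" if "t \<in> {a..b}" for t
      using has_integral_0_cbox_imp_0[of a b f t] int that ab by (force simp: f_def box_real)
    have zero: "w t * (P t \<bullet> P t) = 0" "(\<Sum>\<sigma>\<in>M. ?u t $ \<sigma> * ?u t $ \<sigma>) = 0" if "t \<in> {a..b}" for t
      using f0[OF that] unfolding f_def add_nonneg_eq_0_iff[OF nonneg] by blast+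
    \<comment> \<open>The weight is positive only in the interior, so there \<open>P\<close>
      vanishes at once; continuity carries this to the endpoints.\<close>
    have "P t = 0" if "t \<in> {a<..<b}" for t
      using zero(1)[of t] that by (auto simp: w_def)
    then have P0: "P t = 0" if "t \<in> {a..b}" for t
      using continuous_constant_on_closure[of "{a<..<b}" P 0 t] contP ab that by simp
    show ?R
    proof (intro ballI conjI allI)
      fix t assume t: "t \<in> {a..b}"
      \<comment> \<open>Pairing \<open>P t = 0\<close> with the vector
        \<open>Phi \<Psi> (q t) *v ?e\<close>, whose image under \<Psi> is \<open>?e\<close>, gives
        the sum of squares of the components of \<open>E\<close>.\<close>
      let ?e = "\<chi> r. ?E r t"
      have "(\<Sum>r\<in>UNIV. ?E r t * (\<Psi> (q t) *v (Phi \<Psi> (q t) *v ?e)) $ r) = 0"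
        unfolding EP P0[OF t] by simp
      then have "(\<Sum>r\<in>UNIV. ?E r t * ?E r t) = 0"
        unfolding Phi_Psi_mult(2)[of \<Psi> "q t", OF \<Psi>(2)[OF q(2)[OF t]]] by simp
      then show "?E r t = 0" for r
        by (simp add: sum_nonneg_eq_0_iff)
      show "?u t $ \<sigma> = 0" if "\<sigma> \<in> M" for \<sigma>
        using zero(2)[OF t] that by (simp add: sum_nonneg_eq_0_iff)
    qed
  qed
qed

theorem theorem4:
  fixes U :: "(real^'n) set" and M :: "'n set"
    and \<Psi> :: "real^'n \<Rightarrow> real^'n^'n"
    and L :: "real^'n \<Rightarrow> real^'n \<Rightarrow> real"
    and g :: "real^'n \<Rightarrow> real^'n \<Rightarrow> real^'n \<Rightarrow> real"
    and a b :: real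
    and q :: "real \<Rightarrow> real^'n" and \<mu> :: "'n \<Rightarrow> real \<Rightarrow> real"
  assumes "open U" and "a < b"
    and "smooth_on U \<Psi>" and "\<And>x. x \<in> U \<Longrightarrow> invertible (\<Psi> x)"
    and "smooth_on (U \<times> UNIV) (\<lambda>(x, v). L x v)"
    and "smooth_on (U \<times> UNIV \<times> UNIV) (\<lambda>(x, v, Q). g x v Q)"
    and "smooth_on {a..b} q" and "\<And>t. t \<in> {a..b} \<Longrightarrow> q t \<in> U"
    and "\<And>\<sigma>. \<sigma> \<in> M \<Longrightarrow> smooth_on {a..b} (\<mu> \<sigma>)"
  shows "let C = cost \<Psi> M L g;
             u = quasi_vel \<Psi> {a..b} q;
             acc = quasi_acc \<Psi> {a..b} q;
             \<kappa> = kappa \<Psi> C {a..b} q;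
             \<gamma> = (\<lambda>t. hamel \<Psi> (q t))
         in stationary \<Psi> M C U a b q \<mu> \<longleftrightarrow>
            (\<forall>t\<in>{a..b}.
              (\<forall>A\<in>- M.
                 - dtheta \<Psi> (\<lambda>x. C x (u t) (acc t)) A (q t) + ddt {a..b} (\<kappa> A) t
                   - (\<Sum>J\<in>- M. \<Sum>S\<in>- M. \<kappa> J t * \<gamma> t J S A * u t $ S)
                 = (\<Sum>\<tau>\<in>M. \<Sum>S\<in>- M. \<mu> \<tau> t * \<gamma> t \<tau> S A * u t $ S)) \<and>
              (\<forall>\<sigma>\<in>M.
                 - dtheta \<Psi> (\<lambda>x. C x (u t) (acc t)) \<sigma> (q t)
                   - (\<Sum>J\<in>- M. \<Sum>S\<in>- M. \<kappa> J t * \<gamma> t J S \<sigma> * u t $ S)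
                 = (\<Sum>\<tau>\<in>M. \<Sum>S\<in>- M. \<mu> \<tau> t * \<gamma> t \<tau> S \<sigma> * u t $ S) - ddt {a..b} (\<mu> \<sigma>) t) \<and>
              (\<forall>i. ddt {a..b} q t $ i = (\<Sum>S\<in>- M. Phi \<Psi> (q t) $ i $ S * u t $ S)))"
proof -
  let ?C = "cost \<Psi> M L g" and ?u = "quasi_vel \<Psi> {a..b} q" and ?acc = "quasi_acc \<Psi> {a..b} q"
  note C = smooth_on_cost[where M = M, OF assms(1,3,4,5,6)]
  have *: "(\<forall>r. euler_lagrange \<Psi> M ?C {a..b} q \<mu> r t = 0) \<and> (\<forall>\<sigma>\<in>M. ?u t $ \<sigma> = 0) \<longleftrightarrow>
      (\<forall>A\<in>- M.
         - dtheta \<Psi> (\<lambda>x. ?C x (?u t) (?acc t)) A (q t) + ddt {a..b} (kappa \<Psi> ?C {a..b} q A) t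
           - (\<Sum>J\<in>- M. \<Sum>S\<in>- M. kappa \<Psi> ?C {a..b} q J t * hamel \<Psi> (q t) J S A * ?u t $ S)
         = (\<Sum>\<tau>\<in>M. \<Sum>S\<in>- M. \<mu> \<tau> t * hamel \<Psi> (q t) \<tau> S A * ?u t $ S)) \<and>
      (\<forall>\<sigma>\<in>M.
         - dtheta \<Psi> (\<lambda>x. ?C x (?u t) (?acc t)) \<sigma> (q t)
           - (\<Sum>J\<in>- M. \<Sum>S\<in>- M. kappa \<Psi> ?C {a..b} q J t * hamel \<Psi> (q t) J S \<sigma> * ?u t $ S)
         = (\<Sum>\<tau>\<in>M. \<Sum>S\<in>- M. \<mu> \<tau> t * hamel \<Psi> (q t) \<tau> S \<sigma> * ?u t $ S) - ddt {a..b} (\<mu> \<sigma>) t) \<and>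
      (\<forall>i. ddt {a..b} q t $ i = (\<Sum>S\<in>- M. Phi \<Psi> (q t) $ i $ S * ?u t $ S))"
    (is "?E \<and> _ \<longleftrightarrow> ?A \<and> ?B \<and> _") if t: "t \<in> {a..b}" for t
  proof -
    \<comment> \<open>Because \<open>E\<close> sums over all quasi-velocities, its vanishing matches
      the stated equations only where the constraints hold. The equivalence is therefore
      conditional, and \<open>conj\<close> joins it with the unconditional
      \<open>constraints_iff\<close>.\<close>
    have iff: "?E \<longleftrightarrow> ?A \<and> ?B" if u: "\<forall>\<sigma>\<in>M. ?u t $ \<sigma> = 0"
    proof -
      have "?E \<longleftrightarrow> (\<forall>A\<in>- M. euler_lagrange \<Psi> M ?C {a..b} q \<mu> A t = 0) \<and>
          (\<forall>\<sigma>\<in>M. euler_lagrange \<Psi> M ?C {a..b} q \<mu> \<sigma> t = 0)"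
        by blast
      moreover have "euler_lagrange \<Psi> M ?C {a..b} q \<mu> A t = 0 \<longleftrightarrow>
          - dtheta \<Psi> (\<lambda>x. ?C x (?u t) (?acc t)) A (q t) + ddt {a..b} (kappa \<Psi> ?C {a..b} q A) t
           - (\<Sum>J\<in>- M. \<Sum>S\<in>- M. kappa \<Psi> ?C {a..b} q J t * hamel \<Psi> (q t) J S A * ?u t $ S)
         = (\<Sum>\<tau>\<in>M. \<Sum>S\<in>- M. \<mu> \<tau> t * hamel \<Psi> (q t) \<tau> S A * ?u t $ S)" if "A \<in> - M" for A
        using u that by (subst euler_lagrange_constrained) auto
      moreover have "euler_lagrange \<Psi> M ?C {a..b} q \<mu> \<sigma> t = 0 \<longleftrightarrow>
          - dtheta \<Psi> (\<lambda>x. ?C x (?u t) (?acc t)) \<sigma> (q t)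
           - (\<Sum>J\<in>- M. \<Sum>S\<in>- M. kappa \<Psi> ?C {a..b} q J t * hamel \<Psi> (q t) J S \<sigma> * ?u t $ S)
         = (\<Sum>\<tau>\<in>M. \<Sum>S\<in>- M. \<mu> \<tau> t * hamel \<Psi> (q t) \<tau> S \<sigma> * ?u t $ S) - ddt {a..b} (\<mu> \<sigma>) t"
        if "\<sigma> \<in> M" for \<sigma>
        using u that by (subst euler_lagrange_constrained) auto
      ultimately show ?thesis by (simp only: cong: ball_cong)
    qed
    have conj: "E \<and> u \<longleftrightarrow> A \<and> B \<and> c" if "u \<Longrightarrow> E \<longleftrightarrow> A \<and> B" "u \<longleftrightarrow> c" for E u A B c
      using that by blast
    show ?thesis
      by (rule conj[OF iff constraints_iff[of \<Psi> q t M "{a..b}", OF assms(4)[OF assms(8)[OF t]]]])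
  qed
  have "stationary \<Psi> M ?C U a b q \<mu> \<longleftrightarrow>
    (\<forall>t\<in>{a..b}. (\<forall>r. euler_lagrange \<Psi> M ?C {a..b} q \<mu> r t = 0) \<and> (\<forall>\<sigma>\<in>M. ?u t $ \<sigma> = 0))"
    by (rule stationary_iff[where M = M and \<mu> = \<mu> and \<Psi> = \<Psi> and C = ?C,
          OF assms(1-4) C cost_unconstr assms(7-9)])
  then show ?thesis
    unfolding Let_def by (rule trans) (rule ball_cong[OF refl *])
qed

end
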